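(* Let $k$ be a field. (1) Let $I=(x_1^{a_1}\cdots x_n^{a_n})$ and $J=(x_1^{b_1}\cdots x_n^{b_n})$ be principal ideals in $R=k[x_1,\dots,x_n]$, with $\mathbf{a}=(a_1,\dots,a_n),\mathbf{b}=(b_1,\dots,b_n)\in\mathbb{N}^n$ fan ordered. Put $a_0=1$, $b_0=0$, $a_{n+1}=0$, $b_{n+1}=1$. For all $i=0,\dots,n+1$, let $p_i,q_i$ be relatively prime nonnegative integers such that $a_i/b_i=p_i/q_i$ if $b_i\neq 0$; if $b_i=0$, let $p_i=1$, $q_i=0$. Then the Hilbert series of $\mathcal{B}(I,J)$, as a function of $\mathbf{z}=(r,s,m_1,\dots,m_n)$, has denominator equal to $$\prod_{i=1}^{n}(1-m_i)\cdot\prod_{i=0}^{n+1}\Bigl(1-r^{q_i}s^{p_i}\prod_{j=1}^n m_j^{\max(a_jq_i,\,b_jp_i)}\Bigr)$$ when written in its lowest terms. (2) Let $a,b\in\mathbb{N}$, and let $p,q$ be relatively prime nonnegative integers such that $a/b=p/q$ (with $p=1$, $q=0$ if $b=0$). Then the Hilbert series of $\mathcal{B}((x^a),(x^b))$, for the ideals $(x^a),(x^b)$ of $k[x]$, as a function of $(r,s,m)$, has denominator equal to $$(1-m)(1-rm^a)(1-sm^b)(1-r^qs^pm^{pb})$$ when written in lowest terms.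
   Context: $\mathbb{N}$ denotes the nonnegative integers. $(\mathbf{a},\mathbf{b})$ is fan ordered if $a_i/b_i\ge a_{i+1}/b_{i+1}$ for all $i=1,\dots,n-1$, with the convention $a_i/b_i=\infty$ if $b_i=0$. For ideals $I,J$ of a ring $R$, $\mathcal{B}(I,J)=\sum_{r,s\in\mathbb{N}}(I^r\cap J^s)u^rv^s\subseteq R[u,v]$ is their intersection algebra. For principal monomial ideals in $R=k[x_1,\dots,x_n]$ it is an $\mathbb{N}^{n+2}$-graded $k$-algebra spanned over $k$ by monomials $x_1^{\mu_1}\cdots x_n^{\mu_n}u^{\rho}v^{\sigma}$, and its Hilbert series is the formal power series $\sum r^{\rho}s^{\sigma}m_1^{\mu_1}\cdots m_n^{\mu_n}$, the sum running over all monomials $x_1^{\mu_1}\cdots x_n^{\mu_n}u^{\rho}v^{\sigma}$ in $\mathcal{B}(I,J)$; here $r,s,m_1,\dots,m_n$ are indeterminates. In part (2), $n=1$ and $m=m_1$.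
   Formalization: The printed product is the denominator only when the pairs (p_i,q_i), i=0..n+1, are distinct (in (2): a,b>0); otherwise each repeated factor must be taken once, e.g. n=2, a=b=(1,1) has 1-rsm_1m_2 only once. The formal theorem states both. *)

theory Defs
  imports "HOL-Library.Poly_Mapping" "HOL-Library.Extended_Real"
    "HOL-Algebra.Ideal_Product" "HOL-Algebra.Divisibility"
begin

section \<open>Polynomial rings\<close>

text \<open>
  The indeterminates of $k[x_1,\dots,x_n][u,v]$. The Hilbert series lives in indeterminates
  $r$, $s$, $m_1,\dots,m_n$ that record the exponents of $u$, $v$, $x_1,\dots,x_n$; they are indexed
  by the same type, with \<open>U\<close>, \<open>V\<close>, \<open>X i\<close> standing for $r$, $s$, $m_i$.
\<close>

datatype var = U | V | X nat

type_synonym 'c mpoly = "(var \<Rightarrow>\<^sub>0 nat) \<Rightarrow>\<^sub>0 'c"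

definition indet :: "var \<Rightarrow> 'c::comm_ring_1 mpoly"
  where "indet w = Poly_Mapping.single (Poly_Mapping.single w 1) 1"

definition mpoly_ring :: "var set \<Rightarrow> 'c::comm_ring_1 mpoly ring"
  where "mpoly_ring W =
    \<lparr>carrier = {f. \<forall>t \<in> Poly_Mapping.keys f. Poly_Mapping.keys t \<subseteq> W},
     monoid.mult = (*), one = 1, zero = 0, add = (+)\<rparr>"

text \<open>$k[x_1,\dots,x_n]$, where $k$ is the coefficient type.\<close>

definition xring :: "nat \<Rightarrow> 'c::comm_ring_1 mpoly ring"
  where "xring n = mpoly_ring (X ` {1..n})"

definition monomial_ideal :: "nat \<Rightarrow> (nat \<Rightarrow> nat) \<Rightarrow> 'c::comm_ring_1 mpoly set"
  where "monomial_ideal n a = PIdl\<^bsub>xring n\<^esub> (\<Prod>i = 1..n. indet (X i) ^ a i)"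


section \<open>Intersection algebras and their Hilbert series\<close>

text \<open>
  \<open>R\<close> is meant to be a polynomial ring in which \<open>U\<close> and \<open>V\<close> do not occur. Powers of an ideal are
  powers in the monoid of ideals of \<open>R\<close>; in particular $I^0 = R$.
\<close>

definition intersection_algebra ::
    "'c::comm_ring_1 mpoly ring \<Rightarrow> 'c mpoly set \<Rightarrow> 'c mpoly set \<Rightarrow> 'c mpoly set"
  where "intersection_algebra R I J =
    {(\<Sum>(\<rho>, \<sigma>)\<in>S. f \<rho> \<sigma> * indet U ^ \<rho> * indet V ^ \<sigma>) | S f.
       finite S \<and>
       (\<forall>(\<rho>, \<sigma>)\<in>S. f \<rho> \<sigma> \<in> (I [^]\<^bsub>ideals_set R\<^esub> (\<rho>::nat)) \<inter> (J [^]\<^bsub>ideals_set R\<^esub> (\<sigma>::nat)))}"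

text \<open>A formal power series is the function giving its coefficients.\<close>

type_synonym 'c mps = "(var \<Rightarrow>\<^sub>0 nat) \<Rightarrow> 'c"

definition hilbert_series :: "'c::comm_ring_1 mpoly set \<Rightarrow> rat mps"
  where "hilbert_series B = (\<lambda>t. if Poly_Mapping.single t 1 \<in> B then 1 else 0)"

definition mps_mult :: "'c::comm_ring_1 mps \<Rightarrow> 'c mps \<Rightarrow> 'c mps"
  where "mps_mult F G = (\<lambda>t. \<Sum>(t1, t2) | t1 + t2 = t. F t1 * G t2)"

lemma finite_decompositions: "finite {(t1, t2). t1 + t2 = (t :: var \<Rightarrow>\<^sub>0 nat)}"
proof -
  let ?g = "\<lambda>(t1 :: var \<Rightarrow>\<^sub>0 nat, t2 :: var \<Rightarrow>\<^sub>0 nat).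
    restrict (Poly_Mapping.lookup t1) (Poly_Mapping.keys t)"
  let ?D = "{(t1, t2). t1 + t2 = t}"
  have "?g ` ?D \<subseteq> PiE (Poly_Mapping.keys t) (\<lambda>w. {..Poly_Mapping.lookup t w})"
    by (auto simp: lookup_add)
  then have "finite (?g ` ?D)"
    by (rule finite_subset) (intro finite_PiE, auto)
  moreover have "inj_on ?g ?D"
  proof (rule inj_onI, clarify)
    fix s1 s2 t1 t2 :: "var \<Rightarrow>\<^sub>0 nat"
    assume eq: "restrict (Poly_Mapping.lookup s1) (Poly_Mapping.keys (s1 + s2)) =
        restrict (Poly_Mapping.lookup t1) (Poly_Mapping.keys (s1 + s2))"
      and t: "t1 + t2 = s1 + s2"
    have "Poly_Mapping.lookup s1 w = Poly_Mapping.lookup t1 w" for w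
    proof (cases "w \<in> Poly_Mapping.keys (s1 + s2)")
      case True
      then show ?thesis using fun_cong[OF eq, of w] by simp
    next
      case False
      then have "Poly_Mapping.lookup (s1 + s2) w = 0" "Poly_Mapping.lookup (t1 + t2) w = 0"
        using t by (simp_all add: in_keys_iff)
      then show ?thesis by (simp add: lookup_add)
    qed
    then have "s1 = t1" by (simp add: poly_mapping_eqI)
    then show "s1 = t1 \<and> s2 = t2" using t by simp
  qed
  ultimately show ?thesis by (rule finite_imageD)
qed

text \<open>
  \<open>H\<close> is the rational function \<open>N / D\<close>, for some polynomial \<open>N\<close> coprime to \<open>D\<close>, in the indeterminates
  from \<open>W\<close>. This determines \<open>D\<close> up to a unit, that is, a nonzero constant.
\<close>

definition lowest_terms_denominator :: "var set \<Rightarrow> rat mps \<Rightarrow> rat mpoly \<Rightarrow> bool"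
  where "lowest_terms_denominator W H D \<longleftrightarrow>
    D \<in> carrier (mpoly_ring W) \<and> D \<noteq> 0 \<and>
    (\<exists>N \<in> carrier (mpoly_ring W).
       mps_mult H (Poly_Mapping.lookup D) = Poly_Mapping.lookup N \<and>
       (\<forall>d \<in> carrier (mpoly_ring W).
          d divides\<^bsub>mpoly_ring W\<^esub> N \<and> d divides\<^bsub>mpoly_ring W\<^esub> D \<longrightarrow> d \<in> Units (mpoly_ring W)))"


section \<open>Fan ordered exponent vectors\<close>

definition ratio :: "nat \<Rightarrow> nat \<Rightarrow> ereal"
  where "ratio a b = (if b = 0 then \<infinity> else ereal (real a / real b))"

definition fan_ordered :: "nat \<Rightarrow> (nat \<Rightarrow> nat) \<Rightarrow> (nat \<Rightarrow> nat) \<Rightarrow> bool"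
  where "fan_ordered n a b \<longleftrightarrow>
    (\<forall>i. 1 \<le> i \<and> i + 1 \<le> n \<longrightarrow> ratio (a i) (b i) \<ge> ratio (a (i + 1)) (b (i + 1)))"

definition reduced_fraction :: "nat \<Rightarrow> nat \<Rightarrow> nat \<Rightarrow> nat \<Rightarrow> bool"
  where "reduced_fraction a b p q \<longleftrightarrow>
    coprime p q \<and>
    (if b = 0 then p = 1 \<and> q = 0
     else q \<noteq> 0 \<and> (of_nat a / of_nat b :: rat) = of_nat p / of_nat q)"

end

theory Submission
  imports Defs
begin

text \<open>
  A monomial with exponent $\mu_j$ of $x_j$ and exponents $\rho,\sigma$ of $u,v$ lies in the
  intersection algebra if and only if $\mu_j \ge \max(a_j\rho, b_j\sigma)$ for all $j$. So the
  Hilbert series $H$ is the indicator series of a submonoid $B$ of $\mathbb{N}^{n+2}$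
  (\<open>hilbert_series_intersection_algebra\<close>), which does not depend on the field.

  The set $B$ consists of the lattice points on or above the graph of a convex function on the quadrant
  of all $(\rho,\sigma)$. The function is linear between consecutive rays $(q_i,p_i)$: fan
  ordering says that the slopes $p_i/q_i$ decrease, and between the rays $k$ and $k+1$ the maximum
  is $a_j\rho$ for $j \le k$ and $b_j\sigma$ for $j > k$. Hence $B$ is a union of simplicial
  cones, spanned by the unit vectors of the $x_j$ and the lifts $e_k, e_{k+1}$ of two
  consecutive rays to the graph. The indicator series of a simplicial cone becomes a polynomial,
  namely the sum over a fundamental parallelepiped, after multiplication with $1 - x^e$ for all its
  generators $e$ (\<open>simplicial_cone_series\<close>). Making the cones half open, so that they are disjoint,
  and adding up shows that $N = H \cdot D$ is a polynomial, where $D$ is the product of $1 - x^e$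
  over the set $E$ of all distinct generators (\<open>polynomial_numerator\<close>).

  It remains to see that no factor cancels. Every $e \in E$ spans an extreme ray of $B$: some linear
  functional $L$ is nonnegative on $B$, zero at $e$ and positive on the rest of $E$ (\<open>x_ray_face\<close>,
  \<open>ray_face\<close>). If $1 - x^e$ divided $N$, then $H$ times the product of the remaining factors would be
  a polynomial. But a factor $1 - x^{e'}$ with $L(e') > 0$ does not change the coefficients at
  exponents with $L = 0$, so the coefficients at the multiples of $e$ would all be 1. The binomials
  $1 - x^e$ are prime since each $e$ is a primitive vector (\<open>prime_one_minus_monom\<close>), so a common
  divisor of $N$ and $D$ is a unit (\<open>lowest_terms_denominator_of_extreme_rays\<close>).

  The second part is the case $n = 1$ of the first.
\<close>

section \<open>Primality of binomials $1 - x^e$\<close>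

text \<open>
  A linear order of the indeterminates makes exponent vectors, with natural or integer entries, a
  linearly ordered cancellative monoid, so that polynomials and Laurent polynomials have no zero
  divisors. Any linear order would do.
\<close>

instantiation var :: linorder
begin

fun var_code :: "var \<Rightarrow> nat" where
  "var_code U = 0"
| "var_code V = 1"
| "var_code (X i) = i + 2"

definition less_eq_var :: "var \<Rightarrow> var \<Rightarrow> bool"
  where "less_eq_var v w \<longleftrightarrow> var_code v \<le> var_code w"

definition less_var :: "var \<Rightarrow> var \<Rightarrow> bool"
  where "less_var v w \<longleftrightarrow> var_code v < var_code w"

instance
proof
  fix v w z :: var
  show "v = w" if "v \<le> w" "w \<le> v"
    using that by (cases v; cases w) (auto simp: less_eq_var_def)
qed (auto simp: less_eq_var_def less_var_def)

end

text \<open>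
  The linear extension of \<open>g\<close> to monoid algebras; it is a ring homomorphism if \<open>g\<close> is additive.
\<close>

definition pushforward :: "('a \<Rightarrow> 'b) \<Rightarrow> ('a \<Rightarrow>\<^sub>0 'c::comm_monoid_add) \<Rightarrow> ('b \<Rightarrow>\<^sub>0 'c)"
  where "pushforward g f = (\<Sum>t\<in>Poly_Mapping.keys f. Poly_Mapping.single (g t) (Poly_Mapping.lookup f t))"

lemma poly_mapping_eq_sum_single:
  "f = (\<Sum>t\<in>Poly_Mapping.keys f. Poly_Mapping.single t (Poly_Mapping.lookup f t))"
proof (rule poly_mapping_eqI)
  fix k
  show "Poly_Mapping.lookup f k = Poly_Mapping.lookup
    (\<Sum>t\<in>Poly_Mapping.keys f. Poly_Mapping.single t (Poly_Mapping.lookup f t)) k"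
    by (auto simp: lookup_sum lookup_single when_def in_keys_iff)
qed

lemma poly_mapping_add_induct [case_names zero single add]:
  fixes f :: "'a \<Rightarrow>\<^sub>0 'c::comm_monoid_add"
  assumes "P 0" "\<And>t c. P (Poly_Mapping.single t c)" "\<And>f g. P f \<Longrightarrow> P g \<Longrightarrow> P (f + g)"
  shows "P f"
proof -
  have "P (\<Sum>t\<in>T. Poly_Mapping.single t (Poly_Mapping.lookup f t))" for T
    by (induction T rule: infinite_finite_induct) (auto intro: assms)
  then show ?thesis
    by (metis (full_types) poly_mapping_eq_sum_single)
qed

lemma pushforward_zero [simp]: "pushforward g 0 = 0"
  by (simp add: pushforward_def)

lemma pushforward_single [simp]:
  "pushforward g (Poly_Mapping.single t c) = Poly_Mapping.single (g t) c"
  by (simp add: pushforward_def)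

lemma pushforward_add: "pushforward g (f + f') = pushforward g f + pushforward g f'"
  unfolding pushforward_def
  by (rule setsum_keys_plus_distrib) (simp_all add: single_add)

lemma pushforward_diff:
  fixes f :: "'a \<Rightarrow>\<^sub>0 'c::ab_group_add"
  shows "pushforward g (f - f') = pushforward g f - pushforward g f'"
  using pushforward_add[of g "f - f'" f'] by (simp add: algebra_simps)

lemma pushforward_pushforward: "pushforward h (pushforward g f) = pushforward (h \<circ> g) f"
  by (induction f rule: poly_mapping_add_induct) (simp_all add: pushforward_add)

lemma pushforward_mult:
  fixes f f' :: "'a::comm_monoid_add \<Rightarrow>\<^sub>0 'c::comm_semiring_0"
    and g :: "'a \<Rightarrow> 'b::comm_monoid_add"
  assumes "\<And>s t. g (s + t) = g s + g t"
  shows "pushforward g (f * f') = pushforward g f * pushforward g f'"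
proof (induction f rule: poly_mapping_add_induct)
  case (single t c)
  show ?case
    by (induction f' rule: poly_mapping_add_induct)
      (simp_all add: pushforward_add mult_single assms distrib_left)
qed (simp_all add: pushforward_add distrib_right)

lemma pushforward_cong:
  assumes "\<And>t. t \<in> Poly_Mapping.keys f \<Longrightarrow> g t = h t"
  shows "pushforward g f = pushforward h f"
  using assms by (simp add: pushforward_def)

lemma pushforward_id: "pushforward (\<lambda>t. t) f = f"
  by (simp add: pushforward_def flip: poly_mapping_eq_sum_single)

abbreviation monom :: "(var \<Rightarrow>\<^sub>0 nat) \<Rightarrow> rat mpoly"
  where "monom e \<equiv> Poly_Mapping.single e 1"

lemma indet_eq: "indet w = monom (Poly_Mapping.single w 1)"
  by (simp add: indet_def)

lemma single_1_inject: "monom s = monom t \<longleftrightarrow> s = t"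
proof
  assume "monom s = monom t"
  then have "Poly_Mapping.keys (monom s) = Poly_Mapping.keys (monom t)" by simp
  then show "s = t" by simp
qed simp

text \<open>
  A telescoping sum: each shift by $e$ multiplies by $x^e$, which is 1 modulo $1 - x^e$.
\<close>

lemma dvd_single_diff:
  fixes e t t' :: "var \<Rightarrow>\<^sub>0 nat"
  assumes "\<And>w. Poly_Mapping.lookup t w = Poly_Mapping.lookup t' w + k * Poly_Mapping.lookup e w"
  shows "1 - monom e dvd Poly_Mapping.single t c - Poly_Mapping.single t' c"
  using assms
proof (induction k arbitrary: t)
  case 0
  then have "t = t'" by (simp add: poly_mapping_eqI)
  then show ?case by simp
next
  case (Suc k)
  define u where "u = t - e"
  have t: "t = u + e"
    by (rule poly_mapping_eqI) (simp add: u_def lookup_add lookup_minus Suc.prems)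
  have "Poly_Mapping.lookup u w = Poly_Mapping.lookup t' w + k * Poly_Mapping.lookup e w" for w
    by (simp add: u_def lookup_minus Suc.prems)
  then have "1 - monom e dvd Poly_Mapping.single u c - Poly_Mapping.single t' c"
    by (rule Suc.IH)
  moreover have "Poly_Mapping.single t c - Poly_Mapping.single u c =
      (1 - monom e) * (- Poly_Mapping.single u c)"
    by (simp add: t algebra_simps mult_single)
  moreover have "Poly_Mapping.single t c - Poly_Mapping.single t' c =
      (Poly_Mapping.single t c - Poly_Mapping.single u c) +
      (Poly_Mapping.single u c - Poly_Mapping.single t' c)"
    by simp
  ultimately show ?case
    by (metis dvd_add dvd_triv_left)
qed

text \<open>
  The quotient by $1 - x^e$ embeds into the ring of Laurent polynomials, which is a domain. If
  $\beta(e) = 1$, then $\varphi(t) = t - \beta(t) e$ identifies two exponents exactly if they differ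
  by a multiple of $e$, and the induced homomorphism of algebras has kernel $(1 - x^e)$. Such a
  $\beta$ exists exactly for primitive vectors $e$.
\<close>

lemma prime_one_minus_monom:
  fixes e :: "var \<Rightarrow>\<^sub>0 nat" and \<beta> :: "(var \<Rightarrow>\<^sub>0 nat) \<Rightarrow> int"
  assumes \<beta>: "\<And>s t. \<beta> (s + t) = \<beta> s + \<beta> t" "\<beta> e = 1"
    and dvd: "1 - monom e dvd f * g"
  shows "1 - monom e dvd f \<or> 1 - monom e dvd g"
proof -
  define \<phi> where "\<phi> t = Poly_Mapping.map int t - frag_cmul (\<beta> t) (Poly_Mapping.map int e)"
    for t :: "var \<Rightarrow>\<^sub>0 nat"
  have lookup_map_int: "Poly_Mapping.lookup (Poly_Mapping.map int t) w = int (Poly_Mapping.lookup t w)"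
    for t :: "var \<Rightarrow>\<^sub>0 nat" and w
    by (simp add: Poly_Mapping.map.rep_eq when_def)
  have lookup_\<phi>: "Poly_Mapping.lookup (\<phi> t) w =
      int (Poly_Mapping.lookup t w) - \<beta> t * int (Poly_Mapping.lookup e w)" for t w
    by (simp add: \<phi>_def lookup_minus lookup_map_int)
  have \<phi>_add: "\<phi> (s + t) = \<phi> s + \<phi> t" for s t
    by (rule poly_mapping_eqI) (simp add: lookup_\<phi> lookup_add \<beta> algebra_simps)
  have \<phi>_zero: "\<phi> 0 = 0"
    using \<phi>_add[of 0 0] by simp
  have \<phi>_e: "\<phi> e = 0"
    by (rule poly_mapping_eqI) (simp add: lookup_\<phi> \<beta>)
  have fibre: "1 - monom e dvd Poly_Mapping.single t c - Poly_Mapping.single t' c"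
    if eq: "\<phi> t = \<phi> t'" for t t' c
  proof -
    have *: "1 - monom e dvd Poly_Mapping.single t c - Poly_Mapping.single t' c"
      if "\<phi> t = \<phi> t'" "\<beta> t \<ge> \<beta> t'" for t t'
    proof (rule dvd_single_diff)
      fix w
      have "int (Poly_Mapping.lookup t w) - \<beta> t * int (Poly_Mapping.lookup e w) =
          int (Poly_Mapping.lookup t' w) - \<beta> t' * int (Poly_Mapping.lookup e w)"
        using that(1) by (metis lookup_\<phi>)
      then have "int (Poly_Mapping.lookup t w) =
          int (Poly_Mapping.lookup t' w + nat (\<beta> t - \<beta> t') * Poly_Mapping.lookup e w)"
        using that(2) by (simp add: algebra_simps)
      then show "Poly_Mapping.lookup t w =
          Poly_Mapping.lookup t' w + nat (\<beta> t - \<beta> t') * Poly_Mapping.lookup e w"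
        by (simp only: of_nat_eq_iff)
    qed
    show ?thesis
    proof (cases "\<beta> t \<ge> \<beta> t'")
      case True
      then show ?thesis using * eq by blast
    next
      case False
      then have "1 - monom e dvd Poly_Mapping.single t' c - Poly_Mapping.single t c"
        using *[of t' t] eq by simp
      then show ?thesis
        by (metis dvd_minus_iff minus_diff_eq)
    qed
  qed
  have kernel: "1 - monom e dvd h" if "pushforward \<phi> h = 0" for h
  proof -
    \<comment> \<open>Replacing every exponent by a chosen representative of its fibre does not change \<open>h\<close>
      modulo $1 - x^e$, and gives 0 because it factors through \<open>\<phi>\<close>.\<close>
    define \<nu> where "\<nu> = inv_into UNIV \<phi> \<circ> \<phi>"
    have "\<phi> (\<nu> t) = \<phi> t" for t
      by (simp add: \<nu>_def f_inv_into_f)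
    then have "1 - monom e dvd h - pushforward \<nu> h"
    proof (induction h rule: poly_mapping_add_induct)
      case (add f g)
      then show ?case
        by (simp add: pushforward_add add_diff_add)
    qed (simp_all add: fibre)
    moreover have "pushforward \<nu> h = 0"
      using that by (simp add: \<nu>_def flip: pushforward_pushforward)
    ultimately show ?thesis by simp
  qed
  have "pushforward \<phi> (1 - monom e) = 0"
    by (simp add: pushforward_diff \<phi>_e \<phi>_zero flip: single_one)
  moreover obtain k where "f * g = (1 - monom e) * k"
    using dvd by (rule dvdE)
  then have "pushforward \<phi> f * pushforward \<phi> g = pushforward \<phi> (1 - monom e) * pushforward \<phi> k"
    by (metis pushforward_mult[OF \<phi>_add])
  ultimately have "pushforward \<phi> f * pushforward \<phi> g = 0"
    by simp
  then show ?thesis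
    using kernel by auto
qed

section \<open>Multiplying power series by polynomials\<close>

definition shift :: "(var \<Rightarrow>\<^sub>0 nat) \<Rightarrow> rat mps \<Rightarrow> rat mps"
  where "shift e F = (\<lambda>t. if \<exists>u. t = u + e then F (t - e) else 0)"

lemma shift_plus [simp]: "shift e F (u + e) = F u"
  by (auto simp: shift_def)

lemma shift_eq_0: "(\<And>u. t = u + e \<Longrightarrow> F u = 0) \<Longrightarrow> shift e F t = 0"
  by (auto simp: shift_def)

lemma lookup_mult_monom:
  "Poly_Mapping.lookup (P * monom e) = shift e (Poly_Mapping.lookup P)"
proof (induction P rule: poly_mapping_add_induct)
  case (single t c)
  show ?case
    by (rule ext, simp add: mult_single lookup_single when_def shift_def) (metis add_diff_cancel_right')
qed (auto simp: shift_def lookup_add distrib_right)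

lemma mps_mult_shift: "mps_mult F (shift e G) = shift e (mps_mult F G)"
proof
  fix t
  show "mps_mult F (shift e G) t = shift e (mps_mult F G) t"
  proof (cases "\<exists>u. t = u + e")
    case True
    then obtain u where t: "t = u + e" by blast
    let ?h = "\<lambda>(t1 :: var \<Rightarrow>\<^sub>0 nat, t2 :: var \<Rightarrow>\<^sub>0 nat). (t1, t2 + e)"
    have "mps_mult F (shift e G) t =
        (\<Sum>(t1, t2)\<in>?h ` {(t1, t2). t1 + t2 = u}. F t1 * shift e G t2)"
      unfolding mps_mult_def
    proof (rule sum.mono_neutral_right[OF finite_decompositions])
      show "?h ` {(t1, t2). t1 + t2 = u} \<subseteq> {(t1, t2). t1 + t2 = t}"
        by (auto simp: t add.assoc)
      show "\<forall>x\<in>{(t1, t2). t1 + t2 = t} - ?h ` {(t1, t2). t1 + t2 = u}.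
          (case x of (t1, t2) \<Rightarrow> F t1 * shift e G t2) = 0"
      proof (intro ballI)
        fix x
        assume x: "x \<in> {(t1, t2). t1 + t2 = t} - ?h ` {(t1, t2). t1 + t2 = u}"
        obtain t1 t2 where t12: "x = (t1, t2)"
          by (cases x)
        have False if "t2 = v + e" for v
        proof -
          have "t1 + v = u"
            using x t by (simp add: t12 that flip: add.assoc)
          then have "x \<in> ?h ` {(t1, t2). t1 + t2 = u}"
            by (intro image_eqI[of _ _ "(t1, v)"]) (simp_all add: t12 that)
          then show False
            using x by blast
        qed
        then have "shift e G t2 = 0"
          by (intro shift_eq_0) blast
        then show "(case x of (t1, t2) \<Rightarrow> F t1 * shift e G t2) = 0"
          by (simp add: t12)
      qed
    qed
    also have "\<dots> = (\<Sum>(t1, t2) | t1 + t2 = u. F t1 * G t2)"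
      by (subst sum.reindex) (auto intro!: inj_onI sum.cong)
    finally show ?thesis
      by (simp add: t mps_mult_def)
  next
    case False
    have "F t1 * shift e G t2 = 0" if "t1 + t2 = t" for t1 t2
      using False that by (metis add.assoc mult_zero_right shift_eq_0)
    then have "mps_mult F (shift e G) t = 0"
      unfolding mps_mult_def by (intro sum.neutral) auto
    then show ?thesis
      using False by (simp add: shift_def)
  qed
qed

lemma mps_mult_one: "mps_mult F (Poly_Mapping.lookup 1) = F"
proof
  fix t
  have "mps_mult F (Poly_Mapping.lookup 1) t =
      (\<Sum>(t1, t2)\<in>{(t, 0 :: var \<Rightarrow>\<^sub>0 nat)}. F t1 * Poly_Mapping.lookup 1 t2)"
    unfolding mps_mult_def
    by (rule sum.mono_neutral_right[OF finite_decompositions])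
      (auto simp: lookup_one when_def split: if_splits)
  then show "mps_mult F (Poly_Mapping.lookup 1) t = F t"
    by simp
qed

lemma mps_mult_diff_right:
  fixes F :: "rat mps"
  shows "mps_mult F (\<lambda>t. G t - G' t) = (\<lambda>t. mps_mult F G t - mps_mult F G' t)"
  by (rule ext) (simp add: mps_mult_def case_prod_unfold right_diff_distrib sum_subtractf)

lemma mps_mult_add_left:
  fixes G :: "rat mps"
  shows "mps_mult (\<lambda>t. F t + F' t) G = (\<lambda>t. mps_mult F G t + mps_mult F' G t)"
  by (rule ext) (simp add: mps_mult_def case_prod_unfold distrib_right sum.distrib)

definition times_one_minus :: "(var \<Rightarrow>\<^sub>0 nat) \<Rightarrow> rat mps \<Rightarrow> rat mps"
  where "times_one_minus e F = (\<lambda>t. F t - shift e F t)"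

lemma lookup_mult_one_minus:
  "Poly_Mapping.lookup (P * (1 - monom e)) = times_one_minus e (Poly_Mapping.lookup P)"
  by (simp add: times_one_minus_def fun_eq_iff right_diff_distrib lookup_minus lookup_mult_monom)

lemma mps_mult_one_minus:
  "mps_mult F (Poly_Mapping.lookup (P * (1 - monom e))) =
    times_one_minus e (mps_mult F (Poly_Mapping.lookup P))"
  by (simp add: lookup_mult_one_minus times_one_minus_def mps_mult_diff_right mps_mult_shift)

lemma nonzero_exponent: "(e :: 'a \<Rightarrow>\<^sub>0 nat) \<noteq> 0 \<Longrightarrow> \<exists>w. Poly_Mapping.lookup e w > 0"
  by (auto simp: poly_mapping_eq_iff fun_eq_iff)

lemma one_minus_monom_nonzero: "e \<noteq> 0 \<Longrightarrow> 1 - monom e \<noteq> 0"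
proof
  assume "e \<noteq> 0" and "1 - monom e = 0"
  then have "Poly_Mapping.keys (1 :: rat mpoly) = Poly_Mapping.keys (monom e)"
    by simp
  then show False
    using \<open>e \<noteq> 0\<close> by simp
qed

text \<open>
  Multiplication by $1 - x^e$ is injective on power series: $F(t)$ is recovered from the product
  and $F(t - e)$, and subtracting $e$ can be repeated only finitely often.
\<close>

lemma times_one_minus_inject:
  assumes "times_one_minus e F = times_one_minus e G" and "e \<noteq> 0"
  shows "F = G"
proof
  obtain w where w: "Poly_Mapping.lookup e w > 0"
    using nonzero_exponent[OF \<open>e \<noteq> 0\<close>] by blast
  fix t
  show "F t = G t"
  proof (induction "Poly_Mapping.lookup t w" arbitrary: t rule: less_induct)
    case less
    have "shift e F t = shift e G t"
    proof (cases "\<exists>u. t = u + e")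
      case True
      then obtain u where "t = u + e" by blast
      then show ?thesis
        using less[of u] w by (simp add: lookup_add)
    qed (simp add: shift_def)
    moreover have "F t - shift e F t = G t - shift e G t"
      using fun_cong[OF assms(1), of t] by (simp add: times_one_minus_def)
    ultimately show ?case by simp
  qed
qed

definition denominator :: "(var \<Rightarrow>\<^sub>0 nat) set \<Rightarrow> rat mpoly"
  where "denominator E = (\<Prod>e\<in>E. 1 - monom e)"

lemma denominator_insert:
  "finite E \<Longrightarrow> e \<notin> E \<Longrightarrow> denominator (insert e E) = denominator E * (1 - monom e)"
  by (simp add: denominator_def mult.commute)

lemma denominator_remove:
  "finite E \<Longrightarrow> e \<in> E \<Longrightarrow> denominator E = denominator (E - {e}) * (1 - monom e)"
  by (simp add: denominator_def prod.remove mult.commute)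

definition additive_weight :: "((var \<Rightarrow>\<^sub>0 nat) \<Rightarrow> int) \<Rightarrow> bool"
  where "additive_weight L \<longleftrightarrow> (\<forall>s t. L (s + t) = L s + L t)"

lemma additive_weight_zero: "additive_weight L \<Longrightarrow> L 0 = 0"
  unfolding additive_weight_def by (metis add_0 add_cancel_right_right)

text \<open>
  In the grading by \<open>L\<close>, every factor $1 - x^e$ is 1 plus terms of positive degree. So multiplying
  a series without terms of negative degree leaves its part of degree 0 unchanged.
\<close>

lemma mps_mult_denominator_face:
  assumes "finite E" and L: "additive_weight L"
    and F: "\<And>t. L t < 0 \<Longrightarrow> F t = 0"
    and E: "\<And>e. e \<in> E \<Longrightarrow> L e > 0"
  shows "(L t < 0 \<longrightarrow> mps_mult F (Poly_Mapping.lookup (denominator E)) t = 0) \<and>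
    (L t = 0 \<longrightarrow> mps_mult F (Poly_Mapping.lookup (denominator E)) t = F t)"
  using \<open>finite E\<close> E
proof (induction E arbitrary: t rule: finite_induct)
  case empty
  then show ?case by (simp add: denominator_def mps_mult_one F)
next
  case (insert e E)
  let ?G = "mps_mult F (Poly_Mapping.lookup (denominator E))"
  have IH: "(L t < 0 \<longrightarrow> ?G t = 0) \<and> (L t = 0 \<longrightarrow> ?G t = F t)" for t
    using insert by simp
  have "shift e ?G t = 0" if "L t \<le> 0"
  proof (rule shift_eq_0)
    fix u
    assume "t = u + e"
    then have "L u < 0"
      using L that insert.prems[of e] by (simp add: additive_weight_def)
    then show "?G u = 0"
      using IH by blast
  qed
  then show ?case
    using insert.hyps IH by (simp add: denominator_insert mps_mult_one_minus times_one_minus_def)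
qed

section \<open>Polynomials in a given set of indeterminates\<close>

lemma carrier_mpoly_ring:
  "f \<in> carrier (mpoly_ring W) \<longleftrightarrow> (\<forall>t\<in>Poly_Mapping.keys f. Poly_Mapping.keys t \<subseteq> W)"
  by (simp add: mpoly_ring_def)

lemma mpoly_ring_mult_closed:
  "f \<in> carrier (mpoly_ring W) \<Longrightarrow> g \<in> carrier (mpoly_ring W) \<Longrightarrow> f * g \<in> carrier (mpoly_ring W)"
proof -
  assume f: "f \<in> carrier (mpoly_ring W)" and g: "g \<in> carrier (mpoly_ring W)"
  have "Poly_Mapping.keys t \<subseteq> W" if t_key: "t \<in> Poly_Mapping.keys (f * g)" for t
  proof -
    obtain a b where t: "t = a + b" and ab: "a \<in> Poly_Mapping.keys f" "b \<in> Poly_Mapping.keys g"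
      using subsetD[OF keys_mult t_key] by blast
    have "Poly_Mapping.keys t \<subseteq> Poly_Mapping.keys a \<union> Poly_Mapping.keys b"
      unfolding t by (rule keys_add)
    moreover have "Poly_Mapping.keys a \<subseteq> W" "Poly_Mapping.keys b \<subseteq> W"
      using f g ab by (simp_all add: carrier_mpoly_ring)
    ultimately show ?thesis by blast
  qed
  then show ?thesis
    by (simp add: carrier_mpoly_ring)
qed

lemma mpoly_ring_add_closed:
  "f \<in> carrier (mpoly_ring W) \<Longrightarrow> g \<in> carrier (mpoly_ring W) \<Longrightarrow> f + g \<in> carrier (mpoly_ring W)"
  using keys_add[of f g] unfolding carrier_mpoly_ring by blast

lemma mpoly_ring_diff_closed:
  "f \<in> carrier (mpoly_ring W) \<Longrightarrow> g \<in> carrier (mpoly_ring W) \<Longrightarrow> f - g \<in> carrier (mpoly_ring W)"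
  using keys_diff[of f g] unfolding carrier_mpoly_ring by blast

lemma mpoly_ring_single_closed:
  "Poly_Mapping.keys t \<subseteq> W \<Longrightarrow> Poly_Mapping.single t c \<in> carrier (mpoly_ring W)"
  by (simp add: carrier_mpoly_ring)

lemma mpoly_ring_zero_closed: "0 \<in> carrier (mpoly_ring W)"
  by (simp add: carrier_mpoly_ring)

lemma mpoly_ring_one_closed: "1 \<in> carrier (mpoly_ring W)"
  by (simp add: carrier_mpoly_ring)

lemma mpoly_ring_one_minus_monom_closed:
  "Poly_Mapping.keys e \<subseteq> W \<Longrightarrow> 1 - monom e \<in> carrier (mpoly_ring W)"
  by (intro mpoly_ring_diff_closed mpoly_ring_one_closed mpoly_ring_single_closed)

lemma denominator_closed:
  "(\<And>e. e \<in> E \<Longrightarrow> Poly_Mapping.keys e \<subseteq> W) \<Longrightarrow> denominator E \<in> carrier (mpoly_ring W)"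
  unfolding denominator_def
  by (induction E rule: infinite_finite_induct)
    (simp_all add: mpoly_ring_one_closed mpoly_ring_mult_closed mpoly_ring_one_minus_monom_closed)

definition polynomial_in :: "var set \<Rightarrow> rat mps \<Rightarrow> bool"
  where "polynomial_in W F \<longleftrightarrow> F \<in> Poly_Mapping.lookup ` carrier (mpoly_ring W)"

lemma polynomial_inI:
  assumes "finite {t. F t \<noteq> 0}" and "\<And>t. F t \<noteq> 0 \<Longrightarrow> Poly_Mapping.keys t \<subseteq> W"
  shows "polynomial_in W F"
proof -
  have "Poly_Mapping.lookup (Abs_poly_mapping F) = F"
    using assms(1) by simp
  moreover from this have "Abs_poly_mapping F \<in> carrier (mpoly_ring W)"
    using assms(2) by (simp add: carrier_mpoly_ring in_keys_iff)
  ultimately show ?thesis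
    unfolding polynomial_in_def by (metis image_eqI)
qed

lemma polynomial_in_add:
  assumes "polynomial_in W F" "polynomial_in W G"
  shows "polynomial_in W (\<lambda>t. F t + G t)"
proof -
  obtain P Q where "P \<in> carrier (mpoly_ring W)" "Q \<in> carrier (mpoly_ring W)"
    "F = Poly_Mapping.lookup P" "G = Poly_Mapping.lookup Q"
    using assms unfolding polynomial_in_def by blast
  then show ?thesis
    unfolding polynomial_in_def
    by (intro image_eqI[of _ _ "P + Q"]) (auto simp: lookup_add intro: mpoly_ring_add_closed)
qed

lemma polynomial_in_times_one_minus:
  assumes "polynomial_in W F" "Poly_Mapping.keys e \<subseteq> W"
  shows "polynomial_in W (times_one_minus e F)"
proof -
  obtain P where "P \<in> carrier (mpoly_ring W)" "F = Poly_Mapping.lookup P"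
    using assms(1) unfolding polynomial_in_def by blast
  then have "times_one_minus e F = Poly_Mapping.lookup (P * (1 - monom e))"
    "P * (1 - monom e) \<in> carrier (mpoly_ring W)"
    using assms(2)
    by (simp_all add: lookup_mult_one_minus mpoly_ring_mult_closed mpoly_ring_one_minus_monom_closed)
  then show ?thesis
    unfolding polynomial_in_def by (rule image_eqI)
qed

text \<open>
  A larger denominator clears whatever a smaller one does, so the pieces of a decomposition can be
  treated one by one, each with its own generators.
\<close>

lemma polynomial_in_denominator_mono:
  assumes "polynomial_in W (mps_mult F (Poly_Mapping.lookup (denominator E)))"
    and "finite E'" and "\<And>e. e \<in> E' \<Longrightarrow> Poly_Mapping.keys e \<subseteq> W" and "E \<subseteq> E'"
  shows "polynomial_in W (mps_mult F (Poly_Mapping.lookup (denominator E')))"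
proof -
  have "polynomial_in W (mps_mult F (Poly_Mapping.lookup (denominator (E \<union> A))))"
    if "finite A" "A \<subseteq> E' - E" for A
    using that
  proof (induction A rule: finite_induct)
    case (insert e A)
    then have "denominator (E \<union> insert e A) = denominator (E \<union> A) * (1 - monom e)"
      using finite_subset[OF assms(4,2)] by (simp add: denominator_insert)
    then show ?case
      using insert assms(3) by (auto simp: mps_mult_one_minus intro: polynomial_in_times_one_minus)
  qed (use assms(1) in simp)
  from this[of "E' - E"] show ?thesis
    using assms(2,4) by (simp add: Un_absorb1)
qed

definition restrict_vars :: "var set \<Rightarrow> (var \<Rightarrow>\<^sub>0 nat) \<Rightarrow> (var \<Rightarrow>\<^sub>0 nat)"
  where "restrict_vars W t = Poly_Mapping.mapp (\<lambda>w k. k when w \<in> W) t"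

lemma lookup_restrict_vars:
  "Poly_Mapping.lookup (restrict_vars W t) w = (Poly_Mapping.lookup t w when w \<in> W)"
  by (simp add: restrict_vars_def lookup_mapp when_def in_keys_iff)

text \<open>
  Setting the indeterminates outside \<open>W\<close> to 1 moves an inverse into the subring.
\<close>

lemma unit_in_mpoly_ring:
  fixes d :: "rat mpoly"
  assumes d: "d \<in> carrier (mpoly_ring W)" and "d dvd 1"
  shows "d \<in> Units (mpoly_ring W)"
proof -
  obtain c where c: "d * c = 1"
    using assms(2) by (metis dvdE)
  let ?\<pi> = "pushforward (restrict_vars W) :: rat mpoly \<Rightarrow> rat mpoly"
  have add: "restrict_vars W (s + t) = restrict_vars W s + restrict_vars W t" for s t
    by (rule poly_mapping_eqI) (simp add: lookup_restrict_vars lookup_add when_def)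
  have id: "?\<pi> f = f" if "f \<in> carrier (mpoly_ring W)" for f
  proof -
    have "?\<pi> f = pushforward (\<lambda>t. t) f"
    proof (rule pushforward_cong)
      fix t
      assume "t \<in> Poly_Mapping.keys f"
      then have "Poly_Mapping.keys t \<subseteq> W"
        using that by (simp add: carrier_mpoly_ring)
      then show "restrict_vars W t = t"
        by (intro poly_mapping_eqI) (auto simp: lookup_restrict_vars when_def in_keys_iff)
    qed
    then show ?thesis by (simp add: pushforward_id)
  qed
  have "?\<pi> f \<in> carrier (mpoly_ring W)" for f
  proof (induction f rule: poly_mapping_add_induct)
    case (single t c)
    have "Poly_Mapping.keys (restrict_vars W t) \<subseteq> W"
      by (auto simp: in_keys_iff lookup_restrict_vars when_def split: if_splits)
    then show ?case by (simp add: mpoly_ring_single_closed)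
  qed (simp_all add: pushforward_add mpoly_ring_add_closed mpoly_ring_zero_closed)
  moreover have "d * ?\<pi> c = 1"
    using pushforward_mult[OF add, of d c] c id[OF d] id[OF mpoly_ring_one_closed] by simp
  ultimately have "\<exists>x\<in>carrier (mpoly_ring W). x * d = 1 \<and> d * x = 1"
    by (intro bexI[of _ "?\<pi> c"]) (simp_all add: mult.commute)
  then show ?thesis
    using d by (simp add: Units_def mpoly_ring_def)
qed

section \<open>A criterion for lowest terms\<close>

text \<open>
  By primality, the factors of the product can be cancelled from the cofactor \<open>c\<close> one at a time.
\<close>

lemma dvd_denominator_unit:
  assumes "finite E"
    and prime: "\<And>e. e \<in> E \<Longrightarrow> \<exists>\<beta>. additive_weight \<beta> \<and> \<beta> e = 1"
    and "d * c = denominator E" and "\<And>e. e \<in> E \<Longrightarrow> \<not> 1 - monom e dvd d"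
  shows "d dvd 1"
  using assms
proof (induction E arbitrary: c rule: finite_induct)
  case empty
  then have "1 = d * c" by (simp add: denominator_def)
  then show ?case by (rule dvdI)
next
  case (insert e E)
  obtain \<beta> where \<beta>: "additive_weight \<beta>" "\<beta> e = 1"
    using insert.prems(1) by blast
  then have "e \<noteq> 0"
    using additive_weight_zero by fastforce
  then have ne: "1 - monom e \<noteq> 0"
    by (rule one_minus_monom_nonzero)
  have D: "d * c = (1 - monom e) * denominator E"
    using insert by (simp add: denominator_insert mult.commute)
  then have "1 - monom e dvd d * c" by simp
  then have "1 - monom e dvd d \<or> 1 - monom e dvd c"
    using \<beta> by (intro prime_one_minus_monom[of \<beta>]) (auto simp: additive_weight_def)
  then obtain c' where "c = (1 - monom e) * c'"
    using insert.prems(3)[of e] by (auto elim: dvdE)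
  then have "(1 - monom e) * (d * c') = (1 - monom e) * denominator E"
    using D by (simp add: mult.left_commute)
  then have "d * c' = denominator E"
    using ne by simp
  then show ?case
    using insert by blast
qed

definition indicator_series :: "(var \<Rightarrow>\<^sub>0 nat) set \<Rightarrow> rat mps"
  where "indicator_series B = (\<lambda>t. if t \<in> B then 1 else 0)"

text \<open>
  The hypothesis \<open>face\<close> says that every element of \<open>E\<close> spans a face of the cone of \<open>B\<close> on which no
  other element of \<open>E\<close> lies; \<open>primitive\<close> says that the entries of each element of \<open>E\<close> have greatest
  common divisor 1. The first keeps $1 - x^e$ from dividing the numerator: the
  pole of the series along $x^e = 1$ is visible on that face alone.
\<close>

theorem lowest_terms_denominator_of_extreme_rays:
  assumes "finite E" and "E \<subseteq> B"
    and zero: "0 \<in> B" and add: "\<And>s t. s \<in> B \<Longrightarrow> t \<in> B \<Longrightarrow> s + t \<in> B"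
    and keys: "\<And>e. e \<in> E \<Longrightarrow> Poly_Mapping.keys e \<subseteq> W"
    and face: "\<And>e. e \<in> E \<Longrightarrow> \<exists>L. additive_weight L \<and> (\<forall>t\<in>B. L t \<ge> 0) \<and> L e = 0 \<and>
      (\<forall>e'\<in>E - {e}. L e' > 0)"
    and primitive: "\<And>e. e \<in> E \<Longrightarrow> \<exists>\<beta>. additive_weight \<beta> \<and> \<beta> e = 1"
    and poly: "polynomial_in W (mps_mult (indicator_series B) (Poly_Mapping.lookup (denominator E)))"
  shows "lowest_terms_denominator W (indicator_series B) (denominator E)"
proof -
  let ?H = "indicator_series B"
  obtain N where N: "N \<in> carrier (mpoly_ring W)"
      "mps_mult ?H (Poly_Mapping.lookup (denominator E)) = Poly_Mapping.lookup N"
    using poly unfolding polynomial_in_def by auto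
  have nonzero: "e \<noteq> 0" if "e \<in> E" for e
    using primitive[OF that] additive_weight_zero by fastforce
  have not_dvd: "\<not> 1 - monom e dvd N" if e: "e \<in> E" for e
  proof
    assume "1 - monom e dvd N"
    then obtain N' where N': "N = N' * (1 - monom e)"
      by (metis dvdE mult.commute)
    \<comment> \<open>If the factor cancelled, the series \<open>?G\<close> would be a polynomial; but its coefficients on the
      face \<open>L = 0\<close> agree with those of \<open>?H\<close>, and that face contains infinitely many points of \<open>B\<close>.\<close>
    let ?G = "mps_mult ?H (Poly_Mapping.lookup (denominator (E - {e})))"
    have "times_one_minus e ?G = times_one_minus e (Poly_Mapping.lookup N')"
      using N(2) unfolding denominator_remove[OF \<open>finite E\<close> e] N' mps_mult_one_minus
      by (simp only: lookup_mult_one_minus)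
    then have G: "?G = Poly_Mapping.lookup N'"
      by (rule times_one_minus_inject) (rule nonzero[OF e])
    obtain L where L: "additive_weight L" "\<forall>t\<in>B. L t \<ge> 0" "L e = 0" "\<forall>e'\<in>E - {e}. L e' > 0"
      using face[OF e] by blast
    define T where "T = {t \<in> B. L t = 0}"
    have "T \<subseteq> Poly_Mapping.keys N'"
    proof
      fix t
      assume t: "t \<in> T"
      have "?H s = 0" if "L s < 0" for s
        using L(2) that by (auto simp: indicator_series_def)
      then have "?G t = ?H t"
        using mps_mult_denominator_face[of "E - {e}" L ?H t] L(1,4) \<open>finite E\<close> t
        by (simp add: T_def)
      then show "t \<in> Poly_Mapping.keys N'"
        using t G by (simp add: T_def indicator_series_def in_keys_iff)
    qed
    then have "finite T"
      by (rule finite_subset) simp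
    obtain w where w: "Poly_Mapping.lookup e w > 0"
      using nonzero_exponent[OF nonzero[OF e]] by blast
    have "0 \<in> T"
      using zero L(1) by (simp add: T_def additive_weight_zero)
    have step: "t + e \<in> T" if "t \<in> T" for t
      using that add \<open>E \<subseteq> B\<close> e L(1,3) by (auto simp: T_def additive_weight_def)
    define k where "k = Max ((\<lambda>t. Poly_Mapping.lookup t w) ` T)"
    have "k \<in> (\<lambda>t. Poly_Mapping.lookup t w) ` T"
      unfolding k_def using \<open>finite T\<close> \<open>0 \<in> T\<close> by (intro Max_in) auto
    then obtain t where "t \<in> T" "Poly_Mapping.lookup t w = k"
      by blast
    moreover have "Poly_Mapping.lookup s w \<le> k" if "s \<in> T" for s
      unfolding k_def using \<open>finite T\<close> that by (intro Max_ge) auto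
    ultimately show False
      using step[of t] w by (fastforce simp: lookup_add)
  qed
  have "d \<in> Units (mpoly_ring W)"
    if d: "d \<in> carrier (mpoly_ring W)" "d divides\<^bsub>mpoly_ring W\<^esub> N"
      "d divides\<^bsub>mpoly_ring W\<^esub> denominator E" for d
  proof (rule unit_in_mpoly_ring[OF d(1)])
    obtain c where "d * c = denominator E"
      using d(3) unfolding factor_def mpoly_ring_def by simp metis
    moreover have "d dvd N"
      using d(2) by (auto simp: factor_def mpoly_ring_def)
    then have "\<not> 1 - monom e dvd d" if "e \<in> E" for e
      using not_dvd[OF that] dvd_trans by blast
    ultimately show "d dvd 1"
      using \<open>finite E\<close> primitive by (intro dvd_denominator_unit[of E d c]) auto
  qed
  moreover have "denominator E \<noteq> 0"
    using \<open>finite E\<close> nonzero one_minus_monom_nonzero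
    by (auto simp only: denominator_def prod_zero_iff)
  ultimately show ?thesis
    unfolding lowest_terms_denominator_def using N denominator_closed[OF keys] by blast
qed

section \<open>The monoid of monomials of the intersection algebra\<close>

lemma cring_mpoly_ring: "cring (mpoly_ring W :: 'c::comm_ring_1 mpoly ring)"
proof (intro cringI abelian_groupI comm_monoidI)
  fix x :: "'c mpoly"
  assume "x \<in> carrier (mpoly_ring W)"
  then have "- x \<in> carrier (mpoly_ring W)"
    using mpoly_ring_diff_closed[OF mpoly_ring_zero_closed, of x W] by simp
  then show "\<exists>y\<in>carrier (mpoly_ring W). y \<oplus>\<^bsub>mpoly_ring W\<^esub> x = \<zero>\<^bsub>mpoly_ring W\<^esub>"
    by (intro bexI[of _ "- x"]) (simp_all add: mpoly_ring_def)
next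
  fix x y :: "'c mpoly"
  assume "x \<in> carrier (mpoly_ring W)" "y \<in> carrier (mpoly_ring W)"
  then show "x \<oplus>\<^bsub>mpoly_ring W\<^esub> y \<in> carrier (mpoly_ring W)"
      "x \<otimes>\<^bsub>mpoly_ring W\<^esub> y \<in> carrier (mpoly_ring W)"
    using mpoly_ring_add_closed[of x W y] mpoly_ring_mult_closed[of x W y]
    by (simp_all add: mpoly_ring_def)
next
  show "\<zero>\<^bsub>mpoly_ring W\<^esub> \<in> carrier (mpoly_ring W :: 'c mpoly ring)"
      "\<one>\<^bsub>mpoly_ring W\<^esub> \<in> carrier (mpoly_ring W :: 'c mpoly ring)"
    by (simp_all add: mpoly_ring_def)
qed (simp_all add: mpoly_ring_def algebra_simps)

lemma (in cring) ideal_prod_PIdl: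
  assumes "g \<in> carrier R" "h \<in> carrier R"
  shows "ideal_prod R (PIdl g) (PIdl h) = PIdl (g \<otimes> h)"
proof -
  have gh: "ideal (PIdl (g \<otimes> h)) R"
    using assms by (simp add: cgenideal_ideal)
  have "ideal_prod R (PIdl g) (PIdl h) = Idl (PIdl (g \<otimes> h))"
    using assms by (simp add: ideal_prod_eq_genideal cgenideal_ideal cgenideal_prod)
  also have "\<dots> = PIdl (g \<otimes> h)"
  proof
    show "Idl (PIdl (g \<otimes> h)) \<subseteq> PIdl (g \<otimes> h)"
      by (rule genideal_minimal[OF gh]) simp
    show "PIdl (g \<otimes> h) \<subseteq> Idl (PIdl (g \<otimes> h))"
      by (rule genideal_self) (rule additive_subgroup.a_subset[OF ideal.axioms(1)[OF gh]])
  qed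
  finally show ?thesis .
qed

lemma (in cring) PIdl_pow:
  assumes g: "g \<in> carrier R"
  shows "(PIdl g) [^]\<^bsub>ideals_set R\<^esub> (k::nat) = PIdl (g [^] k)"
proof (induction k)
  case 0
  have "PIdl \<one> = carrier R"
    by (auto simp: cgenideal_def) (metis r_one)
  then show ?case
    by (simp add: nat_pow_def ideals_set_def)
next
  case (Suc k)
  have "(PIdl g) [^]\<^bsub>ideals_set R\<^esub> Suc k = ideal_prod R (PIdl (g [^] k)) (PIdl g)"
    using Suc by (simp add: nat_pow_def ideals_set_def)
  then show ?case
    using g by (simp add: ideal_prod_PIdl)
qed

definition x_exponent :: "nat \<Rightarrow> (nat \<Rightarrow> nat) \<Rightarrow> (var \<Rightarrow>\<^sub>0 nat)"
  where "x_exponent n c = (\<Sum>j = 1..n. Poly_Mapping.single (X j) (c j))"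

lemma lookup_x_exponent [simp]:
  "Poly_Mapping.lookup (x_exponent n c) (X j) = (if j \<in> {1..n} then c j else 0)"
  "Poly_Mapping.lookup (x_exponent n c) U = 0"
  "Poly_Mapping.lookup (x_exponent n c) V = 0"
  by (auto simp: x_exponent_def lookup_sum lookup_single when_def)

lemma keys_x_exponent: "Poly_Mapping.keys (x_exponent n c) \<subseteq> X ` {1..n}"
proof
  fix w
  assume "w \<in> Poly_Mapping.keys (x_exponent n c)"
  then show "w \<in> X ` {1..n}"
    by (cases w) (auto simp: in_keys_iff split: if_splits)
qed

lemma indet_power:
  "(indet w :: 'c::comm_ring_1 mpoly) ^ k = Poly_Mapping.single (Poly_Mapping.single w k) 1"
  by (induction k) (simp_all add: indet_def mult_single flip: single_add)

lemma prod_monomial: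
  "(\<Prod>i\<in>I. Poly_Mapping.single (f i) 1 :: 'c::comm_ring_1 mpoly) =
    Poly_Mapping.single (\<Sum>i\<in>I. f i) 1"
  by (induction I rule: infinite_finite_induct) (simp_all add: mult_single)

lemma prod_indet_power:
  "(\<Prod>j = 1..n. indet (X j) ^ c j :: 'c::comm_ring_1 mpoly) = Poly_Mapping.single (x_exponent n c) 1"
  by (simp add: indet_power prod_monomial x_exponent_def)

text \<open>
  The powers of a principal ideal are generated by the powers of its generator, so that membership of
  a monomial becomes a condition on exponents.
\<close>

lemma monomial_ideal_power:
  "(monomial_ideal n a :: 'c::comm_ring_1 mpoly set) [^]\<^bsub>ideals_set (xring n)\<^esub> k =
    {h * Poly_Mapping.single (x_exponent n (\<lambda>j. a j * k)) 1 | h. h \<in> carrier (xring n)}"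
proof -
  let ?R = "xring n :: 'c mpoly ring" and ?g = "Poly_Mapping.single (x_exponent n a) 1 :: 'c mpoly"
  interpret cring ?R
    unfolding xring_def by (rule cring_mpoly_ring)
  have g: "?g \<in> carrier ?R"
    unfolding xring_def by (intro mpoly_ring_single_closed keys_x_exponent)
  have "?g [^]\<^bsub>?R\<^esub> k = Poly_Mapping.single (x_exponent n (\<lambda>j. a j * k)) 1" for k :: nat
  proof (induction k)
    case 0
    then show ?case by (simp add: xring_def mpoly_ring_def x_exponent_def)
  next
    case (Suc k)
    then have "?g [^]\<^bsub>?R\<^esub> Suc k = Poly_Mapping.single (x_exponent n (\<lambda>j. a j * k)) 1 * ?g"
      by (simp add: xring_def mpoly_ring_def)
    then show ?case
      by (simp add: mult_single x_exponent_def add.commute flip: sum.distrib single_add)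
  qed
  then show ?thesis
    unfolding monomial_ideal_def prod_indet_power
    by (simp add: PIdl_pow[OF g]) (simp add: cgenideal_def xring_def mpoly_ring_def)
qed

definition exponent_monoid :: "nat \<Rightarrow> (nat \<Rightarrow> nat) \<Rightarrow> (nat \<Rightarrow> nat) \<Rightarrow> (var \<Rightarrow>\<^sub>0 nat) set"
  where "exponent_monoid n a b = {t. Poly_Mapping.keys t \<subseteq> {U, V} \<union> X ` {1..n} \<and>
    (\<forall>j\<in>{1..n}. max (a j * Poly_Mapping.lookup t U) (b j * Poly_Mapping.lookup t V)
      \<le> Poly_Mapping.lookup t (X j))}"

lemma single_in_monomial_ideal_power:
  assumes "Poly_Mapping.keys t \<subseteq> X ` {1..n}"
    and "\<And>j. j \<in> {1..n} \<Longrightarrow> a j * k \<le> Poly_Mapping.lookup t (X j)"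
  shows "Poly_Mapping.single t 1 \<in>
    (monomial_ideal n a :: 'c::comm_ring_1 mpoly set) [^]\<^bsub>ideals_set (xring n)\<^esub> k"
proof -
  let ?e = "x_exponent n (\<lambda>j. a j * k)"
  define u where "u = t - ?e"
  have "t = u + ?e"
  proof (rule poly_mapping_eqI)
    fix w
    show "Poly_Mapping.lookup t w = Poly_Mapping.lookup (u + ?e) w"
      using assms(2) by (cases w) (auto simp: u_def lookup_add lookup_minus)
  qed
  then have "Poly_Mapping.single t 1 = Poly_Mapping.single u 1 * (Poly_Mapping.single ?e 1 :: 'c mpoly)"
    by (simp add: mult_single)
  moreover have "Poly_Mapping.keys u \<subseteq> X ` {1..n}"
    using assms(1) by (auto simp: u_def in_keys_iff lookup_minus)
  then have "Poly_Mapping.single u 1 \<in> carrier (xring n :: 'c mpoly ring)"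
    by (simp add: xring_def mpoly_ring_single_closed)
  ultimately show ?thesis
    unfolding monomial_ideal_power by blast
qed

lemma keys_monomial_ideal_power:
  assumes f: "f \<in> (monomial_ideal n a :: 'c::comm_ring_1 mpoly set) [^]\<^bsub>ideals_set (xring n)\<^esub> k"
    and t: "t \<in> Poly_Mapping.keys f"
  shows "Poly_Mapping.keys t \<subseteq> X ` {1..n}"
    and "j \<in> {1..n} \<Longrightarrow> a j * k \<le> Poly_Mapping.lookup t (X j)"
proof -
  let ?e = "x_exponent n (\<lambda>j. a j * k)"
  obtain h where h: "h \<in> carrier (xring n)" and fh: "f = h * Poly_Mapping.single ?e 1"
    using f unfolding monomial_ideal_power by blast
  obtain u where u: "u \<in> Poly_Mapping.keys h" "t = u + ?e"
    using subsetD[OF keys_mult t[unfolded fh]] by (auto split: if_splits)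
  have "Poly_Mapping.keys u \<subseteq> X ` {1..n}"
    using h u(1) by (simp add: xring_def carrier_mpoly_ring)
  then show "Poly_Mapping.keys t \<subseteq> X ` {1..n}"
    using keys_add[of u ?e] keys_x_exponent[of n "\<lambda>j. a j * k"] unfolding u(2) by blast
  show "j \<in> {1..n} \<Longrightarrow> a j * k \<le> Poly_Mapping.lookup t (X j)"
    by (simp add: u(2) lookup_add)
qed

text \<open>
  An intersection algebra of monomial ideals is spanned by monomials: the exponents of \<open>U\<close> and \<open>V\<close> in
  a monomial determine the only summand in which it can occur, since neither occurs in the
  coefficients.
\<close>

lemma single_in_intersection_algebra_iff:
  "Poly_Mapping.single t 1 \<in> intersection_algebra (xring n)
      (monomial_ideal n a :: 'c::comm_ring_1 mpoly set) (monomial_ideal n b) \<longleftrightarrow>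
    t \<in> exponent_monoid n a b"
proof
  let ?u = "Poly_Mapping.lookup t U" and ?v = "Poly_Mapping.lookup t V"
  assume t: "t \<in> exponent_monoid n a b"
  define x where "x = restrict_vars (X ` {1..n}) t"
  have t_eq: "t = x + Poly_Mapping.single U ?u + Poly_Mapping.single V ?v"
  proof (rule poly_mapping_eqI)
    fix w
    have "w \<in> {U, V} \<union> X ` {1..n}" if "Poly_Mapping.lookup t w \<noteq> 0"
    proof -
      have "Poly_Mapping.keys t \<subseteq> {U, V} \<union> X ` {1..n}"
        using t unfolding exponent_monoid_def by blast
      moreover have "w \<in> Poly_Mapping.keys t"
        using that by (simp add: in_keys_iff)
      ultimately show ?thesis by blast
    qed
    then show "Poly_Mapping.lookup t w =
        Poly_Mapping.lookup (x + Poly_Mapping.single U ?u + Poly_Mapping.single V ?v) w"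
      by (cases w) (auto simp: x_def lookup_add lookup_restrict_vars lookup_single when_def)
  qed
  have "Poly_Mapping.keys x \<subseteq> X ` {1..n}"
    by (auto simp: x_def in_keys_iff lookup_restrict_vars when_def split: if_splits)
  moreover have "Poly_Mapping.lookup x (X j) = Poly_Mapping.lookup t (X j)" if "j \<in> {1..n}" for j
    using that by (simp add: x_def lookup_restrict_vars)
  ultimately have "Poly_Mapping.single x 1 \<in>
      ((monomial_ideal n a :: 'c mpoly set) [^]\<^bsub>ideals_set (xring n)\<^esub> ?u) \<inter>
      (monomial_ideal n b [^]\<^bsub>ideals_set (xring n)\<^esub> ?v)"
    using t by (intro IntI single_in_monomial_ideal_power) (auto simp: exponent_monoid_def)
  moreover have "Poly_Mapping.single t 1 =
      (\<Sum>(\<rho>, \<sigma>)\<in>{(?u, ?v)}. (Poly_Mapping.single x 1 :: 'c mpoly) * indet U ^ \<rho> * indet V ^ \<sigma>)"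
    by (subst t_eq) (simp add: indet_power mult_single)
  ultimately show "Poly_Mapping.single t 1 \<in> intersection_algebra (xring n)
      (monomial_ideal n a :: 'c mpoly set) (monomial_ideal n b)"
    unfolding intersection_algebra_def
    by (intro CollectI exI[of _ "{(?u, ?v)}"] exI[of _ "\<lambda>_ _. Poly_Mapping.single x 1"]) auto
next
  assume "Poly_Mapping.single t 1 \<in> intersection_algebra (xring n)
      (monomial_ideal n a :: 'c mpoly set) (monomial_ideal n b)"
  then obtain S f where
    sum: "Poly_Mapping.single t 1 = (\<Sum>(\<rho>, \<sigma>)\<in>S. f \<rho> \<sigma> * indet U ^ \<rho> * indet V ^ \<sigma> :: 'c mpoly)"
    and f: "\<forall>(\<rho>, \<sigma>)\<in>S. f \<rho> \<sigma> \<in> (monomial_ideal n a [^]\<^bsub>ideals_set (xring n)\<^esub> \<rho>) \<inter>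
      (monomial_ideal n b [^]\<^bsub>ideals_set (xring n)\<^esub> \<sigma>)"
    unfolding intersection_algebra_def by blast
  have "(\<Sum>x\<in>S. Poly_Mapping.lookup (case x of (\<rho>, \<sigma>) \<Rightarrow> f \<rho> \<sigma> * indet U ^ \<rho> * indet V ^ \<sigma>) t) = 1"
    using arg_cong[OF sum, of "\<lambda>g. Poly_Mapping.lookup g t"] by (simp add: lookup_sum)
  then obtain x where "x \<in> S"
    "Poly_Mapping.lookup (case x of (\<rho>, \<sigma>) \<Rightarrow> f \<rho> \<sigma> * indet U ^ \<rho> * indet V ^ \<sigma>) t \<noteq> 0"
    by (metis (no_types, lifting) sum.neutral zero_neq_one)
  then obtain \<rho> \<sigma> where S: "(\<rho>, \<sigma>) \<in> S"
    and "Poly_Mapping.lookup (f \<rho> \<sigma> * indet U ^ \<rho> * indet V ^ \<sigma>) t \<noteq> 0"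
    by (cases x) auto
  then have key: "t \<in> Poly_Mapping.keys (f \<rho> \<sigma> *
      Poly_Mapping.single (Poly_Mapping.single U \<rho> + Poly_Mapping.single V \<sigma>) 1)"
    by (simp add: in_keys_iff indet_power mult.assoc mult_single)
  obtain x where x: "x \<in> Poly_Mapping.keys (f \<rho> \<sigma>)"
    and t: "t = x + (Poly_Mapping.single U \<rho> + Poly_Mapping.single V \<sigma>)"
    using subsetD[OF keys_mult key] by (auto split: if_splits)
  have I: "f \<rho> \<sigma> \<in> monomial_ideal n a [^]\<^bsub>ideals_set (xring n)\<^esub> \<rho>"
    and J: "f \<rho> \<sigma> \<in> monomial_ideal n b [^]\<^bsub>ideals_set (xring n)\<^esub> \<sigma>"
    using f S by auto
  note keys_x = keys_monomial_ideal_power(1)[OF I x]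
  have "U \<notin> Poly_Mapping.keys x" "V \<notin> Poly_Mapping.keys x"
    using keys_x by auto
  then have "Poly_Mapping.lookup t U = \<rho>" "Poly_Mapping.lookup t V = \<sigma>"
    by (simp_all add: t lookup_add lookup_single in_keys_iff)
  moreover have "Poly_Mapping.lookup t (X j) = Poly_Mapping.lookup x (X j)" for j
    by (simp add: t lookup_add lookup_single)
  moreover have "Poly_Mapping.keys t \<subseteq> {U, V} \<union> X ` {1..n}"
  proof
    fix w
    assume "w \<in> Poly_Mapping.keys t"
    then show "w \<in> {U, V} \<union> X ` {1..n}"
      using keys_x by (cases w) (auto simp: t in_keys_iff lookup_add lookup_single)
  qed
  ultimately show "t \<in> exponent_monoid n a b"
    using keys_monomial_ideal_power(2)[OF I x] keys_monomial_ideal_power(2)[OF J x]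
    by (simp add: exponent_monoid_def)
qed

lemma hilbert_series_intersection_algebra:
  "hilbert_series (intersection_algebra (xring n)
      (monomial_ideal n a :: 'c::comm_ring_1 mpoly set) (monomial_ideal n b)) =
    indicator_series (exponent_monoid n a b)"
  by (simp add: hilbert_series_def indicator_series_def single_in_intersection_algebra_iff fun_eq_iff)

section \<open>Indicator series of simplicial cones\<close>

lemma finite_bounded_exponents:
  fixes T :: "(var \<Rightarrow>\<^sub>0 nat) set" and m :: "var \<Rightarrow> nat"
  assumes "finite W" and keys: "\<And>t. t \<in> T \<Longrightarrow> Poly_Mapping.keys t \<subseteq> W"
    and le: "\<And>t w. t \<in> T \<Longrightarrow> w \<in> W \<Longrightarrow> Poly_Mapping.lookup t w \<le> m w"
  shows "finite T"
proof -
  let ?S = "{f. \<forall>w. (w \<in> W \<longrightarrow> f w \<in> {..sum m W}) \<and> (w \<notin> W \<longrightarrow> f w = (0::nat))}"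
  have "Poly_Mapping.lookup ` T \<subseteq> ?S"
  proof clarify
    fix t w
    assume t: "t \<in> T"
    have "Poly_Mapping.lookup t w = 0" if "w \<notin> W"
      using keys[OF t] that by (meson in_keys_iff subsetD)
    moreover have "Poly_Mapping.lookup t w \<le> sum m W" if "w \<in> W"
      using le[OF t that] member_le_sum[of w W m] that \<open>finite W\<close> by fastforce
    ultimately show "(w \<in> W \<longrightarrow> Poly_Mapping.lookup t w \<in> {..sum m W}) \<and>
        (w \<notin> W \<longrightarrow> Poly_Mapping.lookup t w = 0)"
      by simp
  qed
  moreover have "finite ?S"
    using \<open>finite W\<close> by (rule finite_set_of_finite_funs) simp
  ultimately have "finite (Poly_Mapping.lookup ` T)"
    by (rule finite_subset)
  then show ?thesis
    by (rule finite_imageD) (simp add: inj_on_def lookup_inject)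
qed

text \<open>
  The functionals \<open>h i\<close> are dual to the generators \<open>r i\<close> up to positive factors. Multiplying by
  $1 - x^{r_i}$ takes the difference of a set and its translate by $r_i$, and this bounds \<open>h i\<close> from
  above while leaving the other coordinates alone; after all generators have been used, only a
  fundamental parallelepiped remains. The offsets \<open>c\<close> make the cone half open. The hypothesis \<open>minus\<close>
  says that \<open>h i\<close> detects divisibility by \<open>r i\<close>: exponents are nonnegative, so \<open>t - r i\<close> need not be
  an exponent vector.
\<close>

lemma simplicial_cone_series:
  fixes r :: "'i \<Rightarrow> (var \<Rightarrow>\<^sub>0 nat)" and h :: "'i \<Rightarrow> (var \<Rightarrow>\<^sub>0 nat) \<Rightarrow> int" and c :: "'i \<Rightarrow> int"
  assumes "finite I"
    and add: "\<And>i. i \<in> I \<Longrightarrow> additive_weight (h i)"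
    and dual: "\<And>i j. i \<in> I \<Longrightarrow> j \<in> I \<Longrightarrow> i \<noteq> j \<Longrightarrow> h i (r j) = 0"
    and pos: "\<And>i. i \<in> I \<Longrightarrow> h i (r i) > 0"
    and plus: "\<And>i t. i \<in> I \<Longrightarrow> t \<in> G \<Longrightarrow> t + r i \<in> G"
    and minus: "\<And>i t. i \<in> I \<Longrightarrow> t \<in> G \<Longrightarrow> (\<And>j. j \<in> I \<Longrightarrow> c j \<le> h j t) \<Longrightarrow>
      c i + h i (r i) \<le> h i t \<Longrightarrow> \<exists>u\<in>G. t = u + r i"
  shows "mps_mult (indicator_series {t \<in> G. \<forall>i\<in>I. c i \<le> h i t})
      (Poly_Mapping.lookup (denominator (r ` I))) =
    indicator_series {t \<in> G. \<forall>i\<in>I. c i \<le> h i t \<and> h i t < c i + h i (r i)}"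
proof -
  define C where "C A = {t \<in> G. (\<forall>i\<in>I. c i \<le> h i t) \<and> (\<forall>i\<in>A. h i t < c i + h i (r i))}" for A
  have inj: "inj_on r I"
  proof (rule inj_onI, rule ccontr)
    fix i j
    assume "i \<in> I" "j \<in> I" "r i = r j" "i \<noteq> j"
    then show False using dual[of i j] pos[of i] by simp
  qed
  have h_plus: "h j (u + r i) = h j u + (if i = j then h i (r i) else 0)"
    if "i \<in> I" "j \<in> I" for i j u
    using that add[of j] dual[of j i] by (auto simp: additive_weight_def)
  have step: "times_one_minus (r i) (indicator_series (C A)) = indicator_series (C (insert i A))"
    if i: "i \<in> I" "i \<notin> A" and A: "A \<subseteq> I" for i A
  proof
    fix t
    show "times_one_minus (r i) (indicator_series (C A)) t = indicator_series (C (insert i A)) t"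
    proof (cases "\<exists>u. t = u + r i")
      case True
      then obtain u where t: "t = u + r i" by blast
      have "(t \<in> C A \<and> h i t \<ge> c i + h i (r i)) \<longleftrightarrow> u \<in> C A"
      proof
        assume "u \<in> C A"
        then have u: "u \<in> G" "\<And>j. j \<in> I \<Longrightarrow> c j \<le> h j u" "\<And>j. j \<in> A \<Longrightarrow> h j u < c j + h j (r j)"
          by (auto simp: C_def)
        have "t \<in> G"
          unfolding t using plus[OF i(1) u(1)] .
        moreover have "c j \<le> h j t" if "j \<in> I" for j
          using u(2)[OF that] h_plus[OF i(1) that, of u] pos[OF i(1)] by (auto simp: t)
        moreover have "h j t < c j + h j (r j)" if "j \<in> A" for j
          using u(3)[OF that] h_plus[OF i(1), of j u] that i A by (auto simp: t)
        moreover have "c i + h i (r i) \<le> h i t"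
          using u(2)[OF i(1)] h_plus[OF i(1) i(1), of u] by (simp add: t)
        ultimately show "t \<in> C A \<and> h i t \<ge> c i + h i (r i)"
          by (simp add: C_def)
      next
        assume t_in: "t \<in> C A \<and> h i t \<ge> c i + h i (r i)"
        then have "\<exists>u\<in>G. t = u + r i"
          by (intro minus[OF i(1)]) (auto simp: C_def)
        then have "u \<in> G"
          by (simp add: t)
        moreover have "c j \<le> h j u" if "j \<in> I" for j
          using t_in h_plus[OF i(1) that, of u] that by (auto simp: C_def t split: if_splits)
        moreover have "h j u < c j + h j (r j)" if "j \<in> A" for j
        proof -
          have "j \<in> I" "i \<noteq> j"
            using that i A by auto
          then have "h j t = h j u"
            using h_plus[OF i(1), of j u] by (simp add: t)
          then show ?thesis
            using t_in that by (auto simp: C_def)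
        qed
        ultimately show "u \<in> C A"
          by (simp add: C_def)
      qed
      then show ?thesis
        by (auto simp: times_one_minus_def indicator_series_def t C_def not_less)
    next
      case False
      have "h i t < c i + h i (r i)" if "t \<in> C A"
      proof (rule ccontr)
        assume "\<not> h i t < c i + h i (r i)"
        then have "\<exists>u\<in>G. t = u + r i"
          using that by (intro minus[OF i(1)]) (auto simp: C_def)
        then show False
          using False by blast
      qed
      then have "t \<in> C (insert i A) \<longleftrightarrow> t \<in> C A"
        by (auto simp: C_def)
      then show ?thesis
        using False by (simp add: times_one_minus_def shift_def indicator_series_def)
    qed
  qed
  have "mps_mult (indicator_series (C {})) (Poly_Mapping.lookup (denominator (r ` A))) =
      indicator_series (C A)" if "A \<subseteq> I" for A
    using finite_subset[OF that \<open>finite I\<close>] that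
  proof (induction A rule: finite_induct)
    case empty
    then show ?case by (simp add: denominator_def mps_mult_one)
  next
    case (insert i A)
    then have "r i \<notin> r ` A"
      using inj by (simp add: inj_on_image_mem_iff)
    then show ?case
      using insert step[of i A] by (simp add: denominator_insert mps_mult_one_minus)
  qed
  from this[of I] show ?thesis
    by (simp add: C_def ball_conj_distrib)
qed

lemma exponent_divides:
  fixes t e :: "var \<Rightarrow>\<^sub>0 nat"
  assumes "\<And>w. Poly_Mapping.lookup e w \<le> Poly_Mapping.lookup t w"
  shows "t = (t - e) + e" and "Poly_Mapping.keys (t - e) \<subseteq> Poly_Mapping.keys t"
proof -
  show "t = (t - e) + e"
    by (rule poly_mapping_eqI) (simp add: lookup_add lookup_minus assms)
  show "Poly_Mapping.keys (t - e) \<subseteq> Poly_Mapping.keys t"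
    by (auto simp: in_keys_iff lookup_minus)
qed

lemma keys_plus_subset:
  "Poly_Mapping.keys s \<subseteq> W \<Longrightarrow> Poly_Mapping.keys t \<subseteq> W \<Longrightarrow> Poly_Mapping.keys (s + t) \<subseteq> W"
  using keys_add[of s t] by blast

lemma mps_mult_indicator_empty: "mps_mult (indicator_series {}) G = (\<lambda>_. 0)"
  by (rule ext) (simp add: mps_mult_def indicator_series_def case_prod_unfold)

lemma polynomial_in_zero: "polynomial_in W (\<lambda>_. 0)"
  by (rule polynomial_inI) simp_all

lemma polynomial_in_indicator:
  assumes "finite C" "\<And>t. t \<in> C \<Longrightarrow> Poly_Mapping.keys t \<subseteq> W"
  shows "polynomial_in W (indicator_series C)"
  using assms by (intro polynomial_inI) (auto simp: indicator_series_def split: if_splits)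

lemma indicator_series_disjoint_Un:
  "C \<inter> D = {} \<Longrightarrow> indicator_series (C \<union> D) = (\<lambda>t. indicator_series C t + indicator_series D t)"
  by (auto simp: indicator_series_def fun_eq_iff)

section \<open>The fan of a pair of exponent vectors\<close>

lemma coprime_bezout_nat:
  assumes "coprime (x::nat) y"
  shows "\<exists>u v. u * int x + v * int y = 1"
  using bezout_int[of "int x" "int y"] assms by (simp add: coprime_iff_gcd_eq_1)

text \<open>
  The indices 0 and \<open>n + 1\<close> stand for the two axes of the quadrant, traversed from the \<open>V\<close>-axis
  (slope \<open>\<infinity>\<close>) to the \<open>U\<close>-axis (slope 0).
\<close>

locale fan =
  fixes n :: nat and a b p q :: "nat \<Rightarrow> nat"
  assumes ordered: "fan_ordered n a b"
    and ends: "a 0 = 1" "b 0 = 0" "a (n + 1) = 0" "b (n + 1) = 1"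
    and reduced: "i \<le> n + 1 \<Longrightarrow> reduced_fraction (a i) (b i) (p i) (q i)"
begin

lemma coprime_pq: "i \<le> n + 1 \<Longrightarrow> coprime (p i) (q i)"
  using reduced by (simp add: reduced_fraction_def)

text \<open>
  The factor is the greatest common divisor of \<open>a i\<close> and \<open>b i\<close>, and 0 if both vanish.
\<close>

lemma fraction_multiple:
  assumes "i \<le> n + 1"
  obtains g where "a i = g * p i" "b i = g * q i"
proof (cases "b i = 0")
  case True
  then show ?thesis
    using reduced[OF assms] that[of "a i"] by (simp add: reduced_fraction_def)
next
  case False
  then have q: "q i \<noteq> 0" and "of_nat (a i) / of_nat (b i) = (of_nat (p i) / of_nat (q i) :: rat)"
    using reduced[OF assms] by (simp_all add: reduced_fraction_def)
  then have "(of_nat (a i * q i) :: rat) = of_nat (b i * p i)"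
    using False by (simp add: field_simps)
  then have eq: "a i * q i = b i * p i"
    by (simp only: of_nat_eq_iff)
  then have "q i dvd b i * p i"
    by (metis dvd_triv_right)
  then have "q i dvd b i"
    using coprime_pq[OF assms] by (metis coprime_commute coprime_dvd_mult_left_iff)
  then obtain g where g: "b i = g * q i"
    by (metis dvdE mult.commute)
  then have "a i * q i = (g * p i) * q i"
    using eq by (simp only: mult.assoc mult.commute[of "q i" "p i"])
  then have "a i = g * p i"
    using q by (simp only: mult_cancel2) simp
  then show ?thesis
    using g that by blast
qed

lemma pq_first: "p 0 = 1" "q 0 = 0"
  using reduced[of 0] ends by (simp_all add: reduced_fraction_def)

lemma pq_last: "p (n + 1) = 0" "q (n + 1) = 1"
proof -
  obtain g where "a (n + 1) = g * p (n + 1)" "b (n + 1) = g * q (n + 1)"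
    using fraction_multiple[of "n + 1"] by auto
  then show "p (n + 1) = 0" "q (n + 1) = 1"
    using ends by simp_all
qed

lemma ratio_antimono:
  assumes "i \<le> j" "1 \<le> i" "j \<le> n"
  shows "ratio (a j) (b j) \<le> ratio (a i) (b i)"
  using assms
proof (induction j rule: dec_induct)
  case (step j)
  then have "ratio (a (Suc j)) (b (Suc j)) \<le> ratio (a j) (b j)"
    using ordered by (simp add: fan_ordered_def)
  then show ?case
    using step by (meson Suc_leD order_trans)
qed simp

lemma slope_antimono:
  assumes "i \<le> j" "j \<le> n + 1"
  shows "p j * q i \<le> p i * q j"
proof (cases "b i = 0 \<or> j = n + 1")
  case True
  then show ?thesis
    using reduced[of i] assms pq_last by (auto simp: reduced_fraction_def)
next
  case False
  then have i: "1 \<le> i" and j: "j \<le> n"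
    using assms ends(2) by (cases i; simp)+
  have le: "ratio (a j) (b j) \<le> ratio (a i) (b i)"
    using ratio_antimono assms(1) i j by blast
  then have bj: "b j \<noteq> 0"
    using False by (auto simp: ratio_def split: if_splits)
  have "real (a j) / real (b j) \<le> real (a i) / real (b i)"
    using le bj False by (simp add: ratio_def)
  then have "real (a j * b i) \<le> real (a i * b j)"
    using bj False by (simp add: field_simps)
  then have ab: "a j * b i \<le> a i * b j"
    by (simp only: of_nat_le_iff)
  obtain g where g: "a i = g * p i" "b i = g * q i"
    using fraction_multiple[of i] assms by auto
  obtain g' where g': "a j = g' * p j" "b j = g' * q j"
    using fraction_multiple[OF assms(2)] .
  have "(g * g') * (p j * q i) \<le> (g * g') * (p i * q j)"
    using ab by (simp add: g g' ac_simps)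
  moreover have "g * g' > 0"
    using False bj g g' by simp
  ultimately show ?thesis
    by simp
qed

text \<open>
  The sign of this functional tells on which side of the ray $(q_i,p_i)$ the point with coordinates
  given by the exponents of \<open>U\<close> and \<open>V\<close> lies: it is nonnegative on and below the ray and
  nonpositive on and above it. Slopes are compared without division, since $q_i$ may be 0.
\<close>

definition slope_gap :: "nat \<Rightarrow> (var \<Rightarrow>\<^sub>0 nat) \<Rightarrow> int"
  where "slope_gap i t = int (p i * Poly_Mapping.lookup t U) - int (q i * Poly_Mapping.lookup t V)"

lemma slope_gap_additive: "additive_weight (slope_gap i)"
  by (simp add: additive_weight_def slope_gap_def lookup_add algebra_simps)

text \<open>
  The rays are ordered by decreasing slope, so a point below ray \<open>j\<close> is also below every earlier ray,
  and a point above ray \<open>i\<close> is above every later one. The identities \<open>q\<close> and \<open>p\<close> express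
  this without dividing; if the factor on the left vanishes, the ray concerned lies on an axis.
\<close>

lemma slope_gap_mono:
  assumes "i \<le> j" "j \<le> n + 1"
  shows "0 \<le> slope_gap j t \<Longrightarrow> 0 \<le> slope_gap i t" and "slope_gap i t \<le> 0 \<Longrightarrow> slope_gap j t \<le> 0"
proof -
  let ?D = "int (p i) * int (q j) - int (p j) * int (q i)"
    and ?x = "int (Poly_Mapping.lookup t U)" and ?y = "int (Poly_Mapping.lookup t V)"
  have "int (p j * q i) \<le> int (p i * q j)"
    using slope_antimono[OF assms] by (simp only: of_nat_le_iff)
  then have D: "?D \<ge> 0" by simp
  have q: "int (q j) * slope_gap i t = int (q i) * slope_gap j t + ?D * ?x"
    by (simp add: slope_gap_def algebra_simps)
  have p: "int (p i) * slope_gap j t = int (p j) * slope_gap i t - ?D * ?y"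
    by (simp add: slope_gap_def algebra_simps)
  show "0 \<le> slope_gap i t" if "0 \<le> slope_gap j t"
  proof (cases "q j = 0")
    case True
    then have "p j = 1"
      using coprime_pq[OF assms(2)] by simp
    then have "q i = 0"
      using slope_antimono[OF assms] True by simp
    then show ?thesis by (simp add: slope_gap_def)
  next
    case False
    have "0 \<le> int (q j) * slope_gap i t"
      unfolding q using that D by simp
    then show ?thesis
      using False by (simp add: zero_le_mult_iff)
  qed
  show "slope_gap j t \<le> 0" if "slope_gap i t \<le> 0"
  proof (cases "p i = 0")
    case True
    then have "q i = 1"
      using coprime_pq[of i] assms by simp
    then have "p j = 0"
      using slope_antimono[OF assms] True by simp
    then show ?thesis by (simp add: slope_gap_def)
  next
    case False
    have "int (p j) * slope_gap i t \<le> 0"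
      using that by (simp add: mult_le_0_iff)
    moreover have "?D * ?y \<ge> 0"
      using D by simp
    ultimately have "int (p i) * slope_gap j t \<le> 0"
      unfolding p by linarith
    then show ?thesis
      using False by (simp add: mult_le_0_iff)
  qed
qed

lemma slope_gap_compare:
  assumes "j \<le> n + 1"
  shows "0 \<le> slope_gap j t \<Longrightarrow> b j * Poly_Mapping.lookup t V \<le> a j * Poly_Mapping.lookup t U"
    and "slope_gap j t \<le> 0 \<Longrightarrow> a j * Poly_Mapping.lookup t U \<le> b j * Poly_Mapping.lookup t V"
proof -
  obtain g where g: "a j = g * p j" "b j = g * q j"
    using fraction_multiple[OF assms] .
  show "b j * Poly_Mapping.lookup t V \<le> a j * Poly_Mapping.lookup t U" if "0 \<le> slope_gap j t"
  proof -
    have "q j * Poly_Mapping.lookup t V \<le> p j * Poly_Mapping.lookup t U"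
      using that by (simp add: slope_gap_def flip: of_nat_mult)
    then show ?thesis by (simp add: g mult.assoc)
  qed
  show "a j * Poly_Mapping.lookup t U \<le> b j * Poly_Mapping.lookup t V" if "slope_gap j t \<le> 0"
  proof -
    have "p j * Poly_Mapping.lookup t U \<le> q j * Poly_Mapping.lookup t V"
      using that by (simp add: slope_gap_def flip: of_nat_mult)
    then show ?thesis by (simp add: g mult.assoc)
  qed
qed

abbreviation "W \<equiv> {U, V} \<union> X ` {1..n}"

abbreviation "B \<equiv> exponent_monoid n a b"

definition x_ray :: "nat \<Rightarrow> (var \<Rightarrow>\<^sub>0 nat)"
  where "x_ray j = Poly_Mapping.single (X j) 1"

text \<open>
  The lift of the ray $(q_i,p_i)$ to the graph of the function that bounds \<open>B\<close> from below; it is the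
  exponent of the monomial in the \<open>i\<close>-th factor of the denominator.
\<close>

definition ray :: "nat \<Rightarrow> (var \<Rightarrow>\<^sub>0 nat)"
  where "ray i = Poly_Mapping.single U (q i) + Poly_Mapping.single V (p i) +
    x_exponent n (\<lambda>j. max (a j * q i) (b j * p i))"

text \<open>
  A set, so that coinciding rays contribute a single factor.
\<close>

definition rays :: "(var \<Rightarrow>\<^sub>0 nat) set"
  where "rays = x_ray ` {1..n} \<union> ray ` {0..n + 1}"

lemma lookup_x_ray [simp]:
  "Poly_Mapping.lookup (x_ray j) U = 0" "Poly_Mapping.lookup (x_ray j) V = 0"
  "Poly_Mapping.lookup (x_ray j) (X l) = (if l = j then 1 else 0)"
  by (auto simp: x_ray_def lookup_single when_def)

lemma lookup_ray [simp]:
  "Poly_Mapping.lookup (ray i) U = q i" "Poly_Mapping.lookup (ray i) V = p i"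
  "Poly_Mapping.lookup (ray i) (X j) = (if j \<in> {1..n} then max (a j * q i) (b j * p i) else 0)"
  by (auto simp: ray_def lookup_add lookup_single when_def)

lemma keys_x_ray: "j \<in> {1..n} \<Longrightarrow> Poly_Mapping.keys (x_ray j) \<subseteq> W"
  by (auto simp: x_ray_def)

lemma keys_ray: "Poly_Mapping.keys (ray i) \<subseteq> W"
proof
  fix w
  assume "w \<in> Poly_Mapping.keys (ray i)"
  then show "w \<in> W"
    by (cases w) (auto simp: in_keys_iff split: if_splits)
qed

lemma slope_gap_x_ray [simp]: "slope_gap i (x_ray j) = 0"
  by (simp add: slope_gap_def)

lemma slope_gap_ray: "slope_gap i (ray j) = int (p i * q j) - int (q i * p j)"
  by (simp add: slope_gap_def)

lemma finite_rays: "finite rays"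
  by (simp add: rays_def)

lemma keys_rays: "e \<in> rays \<Longrightarrow> Poly_Mapping.keys e \<subseteq> W"
  using keys_x_ray keys_ray unfolding rays_def by blast

lemma finite_W: "finite W"
  by simp

text \<open>
  Between the rays \<open>k\<close> and \<open>k + 1\<close> the lower bound \<open>\<psi> j\<close> for the exponent of \<open>X j\<close> is linear. So this
  part of \<open>B\<close> is a simplicial cone with generators \<open>ray k\<close>, \<open>ray (k + 1)\<close> and the \<open>x_ray j\<close>, whose dual
  coordinates are the two slope gaps and the heights above the bounds. It is half open: the
  points over the second ray belong to the next cone.
\<close>

lemma polynomial_cone:
  assumes k: "k \<le> n"
  shows "polynomial_in W (mps_mult (indicator_series {t \<in> B. 0 \<le> slope_gap k t \<and> slope_gap (k + 1) t < 0})
    (Poly_Mapping.lookup (denominator rays)))"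
proof -
  let ?C = "{t \<in> B. 0 \<le> slope_gap k t \<and> slope_gap (k + 1) t < 0}"
  \<comment> \<open>The determinant of the two rays; if it is 0, they coincide and the cone is empty.
    The equations below express points in terms of the rays by Cramer's rule.\<close>
  define d where "d = int (p k * q (k + 1)) - int (p (k + 1) * q k)"
  have "int (p (k + 1) * q k) \<le> int (p k * q (k + 1))"
    using slope_antimono[of k "k + 1"] k by (simp only: of_nat_le_iff)
  then have d0: "d \<ge> 0"
    by (simp add: d_def)
  have U_eq: "d * int (Poly_Mapping.lookup t U) =
      - slope_gap (k + 1) t * int (q k) + slope_gap k t * int (q (k + 1))" for t
    by (simp add: d_def slope_gap_def algebra_simps)
  have V_eq: "d * int (Poly_Mapping.lookup t V) =
      - slope_gap (k + 1) t * int (p k) + slope_gap k t * int (p (k + 1))" for t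
    by (simp add: d_def slope_gap_def algebra_simps)
  show ?thesis
  proof (cases "d = 0")
    case True
    have "?C = {}"
    proof (rule ccontr)
      assume "?C \<noteq> {}"
      then obtain t where t: "0 \<le> slope_gap k t" "slope_gap (k + 1) t < 0" by blast
      have "- slope_gap (k + 1) t * int (q k) \<ge> 0" "slope_gap k t * int (q (k + 1)) \<ge> 0"
        "- slope_gap (k + 1) t * int (p k) \<ge> 0" "slope_gap k t * int (p (k + 1)) \<ge> 0"
        using t by (simp_all add: mult_le_0_iff)
      moreover have "0 = - slope_gap (k + 1) t * int (q k) + slope_gap k t * int (q (k + 1))"
        "0 = - slope_gap (k + 1) t * int (p k) + slope_gap k t * int (p (k + 1))"
        using U_eq[of t] V_eq[of t] True by (simp_all only: mult_zero_left)
      ultimately have "- slope_gap (k + 1) t * int (q k) = 0 \<and> - slope_gap (k + 1) t * int (p k) = 0"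
        by linarith
      then have "q k = 0" "p k = 0"
        using t(2) by simp_all
      then show False
        using coprime_pq[of k] k by simp
    qed
    then show ?thesis
      by (simp only: mps_mult_indicator_empty polynomial_in_zero)
  next
    case False
    with d0 have d: "d > 0" by simp
    define \<psi> where "\<psi> j t = (if j \<le> k then a j * Poly_Mapping.lookup t U
      else b j * Poly_Mapping.lookup t V)" for j and t :: "var \<Rightarrow>\<^sub>0 nat"
    have max_\<psi>: "max (a j * Poly_Mapping.lookup t U) (b j * Poly_Mapping.lookup t V) = \<psi> j t"
      if "j \<le> n" "0 \<le> slope_gap k t" "slope_gap (k + 1) t \<le> 0" for j t
    proof (cases "j \<le> k")
      case True
      then have "0 \<le> slope_gap j t"
        using slope_gap_mono(1)[of j k t] that k by simp
      then show ?thesis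
        using slope_gap_compare(1)[of j t] that True by (simp add: \<psi>_def)
    next
      case False
      then have "slope_gap j t \<le> 0"
        using slope_gap_mono(2)[of "k + 1" j t] that by simp
      then show ?thesis
        using slope_gap_compare(2)[of j t] that False by (simp add: \<psi>_def)
    qed
    define r where "r i = (if i = 0 then ray k else if i = n + 1 then ray (k + 1) else x_ray i)" for i
    define h where "h i t = (if i = 0 then - slope_gap (k + 1) t
      else if i = n + 1 then slope_gap k t
      else int (Poly_Mapping.lookup t (X i)) - int (\<psi> i t))" for i t
    \<comment> \<open>The offset 1 encodes the strict inequality that excludes the points over the ray \<open>k + 1\<close>.\<close>
    define c where "c i = (if i = 0 then 1 else 0 :: int)" for i :: nat
    let ?I = "{0..n + 1}" and ?G = "{t. Poly_Mapping.keys t \<subseteq> W}"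
    have gaps: "slope_gap k (ray k) = 0" "slope_gap (k + 1) (ray (k + 1)) = 0"
      "slope_gap k (ray (k + 1)) = d" "slope_gap (k + 1) (ray k) = - d"
      by (simp_all add: slope_gap_ray d_def mult.commute)
    have ray_\<psi>: "Poly_Mapping.lookup (ray i) (X j) = \<psi> j (ray i)"
      if "j \<in> {1..n}" "i = k \<or> i = k + 1" for i j
      using max_\<psi>[of j "ray i"] that gaps d by auto
    have keys_r: "Poly_Mapping.keys (r i) \<subseteq> W" if "i \<in> ?I" for i
      using that keys_ray keys_x_ray[of i] by (auto simp: r_def)
    have \<psi>_x_ray: "\<psi> j (x_ray i) = 0" for i j
      by (simp add: \<psi>_def)
    have cone: "{t \<in> ?G. \<forall>i\<in>?I. c i \<le> h i t} = ?C"
    proof -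
      have "t \<in> ?C \<longleftrightarrow> t \<in> ?G \<and> (\<forall>i\<in>?I. c i \<le> h i t)" for t
      proof -
        have split: "(\<forall>i\<in>?I. c i \<le> h i t) \<longleftrightarrow>
            slope_gap (k + 1) t < 0 \<and> 0 \<le> slope_gap k t \<and>
            (\<forall>j\<in>{1..n}. \<psi> j t \<le> Poly_Mapping.lookup t (X j))"
        proof -
          have "?I = insert 0 (insert (n + 1) {1..n})" by auto
          then show ?thesis
            by (auto simp: h_def c_def)
        qed
        show ?thesis
        proof (cases "0 \<le> slope_gap k t \<and> slope_gap (k + 1) t < 0")
          case True
          then have "(\<forall>j\<in>{1..n}. max (a j * Poly_Mapping.lookup t U) (b j * Poly_Mapping.lookup t V)
              \<le> Poly_Mapping.lookup t (X j)) \<longleftrightarrow>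
            (\<forall>j\<in>{1..n}. \<psi> j t \<le> Poly_Mapping.lookup t (X j))"
            using max_\<psi>[of _ t] by (intro ball_cong) auto
          then show ?thesis
            unfolding split exponent_monoid_def using True by blast
        qed (use split in blast)
      qed
      then show ?thesis by blast
    qed
    have series: "mps_mult (indicator_series {t \<in> ?G. \<forall>i\<in>?I. c i \<le> h i t})
        (Poly_Mapping.lookup (denominator (r ` ?I))) =
      indicator_series {t \<in> ?G. \<forall>i\<in>?I. c i \<le> h i t \<and> h i t < c i + h i (r i)}"
    proof (rule simplicial_cone_series)
      show "additive_weight (h i)" if "i \<in> ?I" for i
        using slope_gap_additive[unfolded additive_weight_def]
        by (auto simp: additive_weight_def h_def \<psi>_def lookup_add algebra_simps)
      show "h i (r j) = 0" if "i \<in> ?I" "j \<in> ?I" "i \<noteq> j" for i j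
        using that ray_\<psi>[of i k] ray_\<psi>[of i "k + 1"] gaps
        by (auto simp: h_def r_def \<psi>_x_ray)
      show "h i (r i) > 0" if "i \<in> ?I" for i
        using that gaps d by (auto simp: h_def r_def \<psi>_x_ray)
      show "t + r i \<in> ?G" if "i \<in> ?I" "t \<in> ?G" for i t
        using that keys_r by (simp add: keys_plus_subset)
      show "\<exists>u\<in>?G. t = u + r i"
        if i: "i \<in> ?I" and t: "t \<in> ?G" and c: "\<And>j. j \<in> ?I \<Longrightarrow> c j \<le> h j t"
          and large: "c i + h i (r i) \<le> h i t" for i t
      proof -
        have gap_k: "0 \<le> slope_gap k t" and gap_k1: "1 \<le> - slope_gap (k + 1) t"
          using c[of 0] c[of "n + 1"] by (auto simp: c_def h_def)
        have x: "\<psi> j t \<le> Poly_Mapping.lookup t (X j)" if "j \<in> {1..n}" for j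
          using c[of j] that by (auto simp: c_def h_def)
        have le_ray: "Poly_Mapping.lookup (ray l) w \<le> Poly_Mapping.lookup t w"
          if l: "l = k \<or> l = k + 1" and U: "q l \<le> Poly_Mapping.lookup t U"
            and V: "p l \<le> Poly_Mapping.lookup t V" for l w
        proof (cases w)
          case (X j)
          show ?thesis
          proof (cases "j \<in> {1..n}")
            case True
            then have "Poly_Mapping.lookup (ray l) (X j) = \<psi> j (ray l)"
              using ray_\<psi> l by blast
            also have "\<dots> \<le> \<psi> j t"
              using U V by (simp add: \<psi>_def)
            finally show ?thesis
              using x[OF True] X by simp
          next
            case False
            then show ?thesis using X by auto
          qed
        qed (use U V in simp_all)
        have "Poly_Mapping.lookup (r i) w \<le> Poly_Mapping.lookup t w" for w
        proof -
          consider "i = 0" | "i = n + 1" | "i \<in> {1..n}"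
            using i by fastforce
          then show ?thesis
          proof cases
            case 1
            then have "d \<le> - slope_gap (k + 1) t"
              using large gaps by (simp add: c_def h_def r_def)
            then have "d * int (q k) \<le> - slope_gap (k + 1) t * int (q k)"
              "d * int (p k) \<le> - slope_gap (k + 1) t * int (p k)"
              by (intro mult_right_mono; simp)+
            moreover have "0 \<le> slope_gap k t * int (q (k + 1))" "0 \<le> slope_gap k t * int (p (k + 1))"
              using gap_k by simp_all
            ultimately have "d * int (q k) \<le> d * int (Poly_Mapping.lookup t U)"
              "d * int (p k) \<le> d * int (Poly_Mapping.lookup t V)"
              unfolding U_eq V_eq by linarith+
            then show ?thesis
              using le_ray[of k w] d 1 by (simp add: r_def)
          next
            case 2
            then have "d \<le> slope_gap k t"
              using large gaps by (simp add: c_def h_def r_def)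
            then have "d * int (q (k + 1)) \<le> slope_gap k t * int (q (k + 1))"
              "d * int (p (k + 1)) \<le> slope_gap k t * int (p (k + 1))"
              by (intro mult_right_mono; simp)+
            moreover have "0 \<le> - slope_gap (k + 1) t * int (q k)" "0 \<le> - slope_gap (k + 1) t * int (p k)"
              using gap_k1 by (simp_all add: mult_le_0_iff)
            ultimately have "d * int (q (k + 1)) \<le> d * int (Poly_Mapping.lookup t U)"
              "d * int (p (k + 1)) \<le> d * int (Poly_Mapping.lookup t V)"
              unfolding U_eq V_eq by linarith+
            then show ?thesis
              using le_ray[of "k + 1" w] d 2 by (simp add: r_def)
          next
            case 3
            then have "1 \<le> Poly_Mapping.lookup t (X i)"
              using large by (auto simp: c_def h_def r_def \<psi>_x_ray)
            then show ?thesis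
              using 3 by (cases w) (auto simp: r_def)
          qed
        qed
        then show ?thesis
          using exponent_divides[of "r i" t] t by (intro bexI[of _ "t - r i"]) auto
      qed
    qed simp
    have "finite {t \<in> ?G. \<forall>i\<in>?I. c i \<le> h i t \<and> h i t < c i + h i (r i)}" (is "finite ?box")
    proof -
      define m where "m w = (case w of U \<Rightarrow> q k + q (k + 1) | V \<Rightarrow> p k + p (k + 1)
        | X j \<Rightarrow> a j * (q k + q (k + 1)) + b j * (p k + p (k + 1)))" for w
      have "Poly_Mapping.lookup t w \<le> m w" if t: "t \<in> ?box" and w: "w \<in> W" for t w
      proof -
        have box: "c i \<le> h i t \<and> h i t < c i + h i (r i)" if "i \<in> ?I" for i
          using t that by blast
        have "0 \<le> slope_gap k t" "slope_gap k t \<le> d"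
          "0 \<le> - slope_gap (k + 1) t" "- slope_gap (k + 1) t \<le> d"
          using box[of 0] box[of "n + 1"] gaps by (auto simp: c_def h_def r_def)
        then have "- slope_gap (k + 1) t * int (q k) \<le> d * int (q k)"
          "- slope_gap (k + 1) t * int (p k) \<le> d * int (p k)"
          "slope_gap k t * int (q (k + 1)) \<le> d * int (q (k + 1))"
          "slope_gap k t * int (p (k + 1)) \<le> d * int (p (k + 1))"
          by (intro mult_right_mono; simp)+
        then have "d * int (Poly_Mapping.lookup t U) \<le> d * int (q k + q (k + 1))"
          "d * int (Poly_Mapping.lookup t V) \<le> d * int (p k + p (k + 1))"
          unfolding U_eq V_eq by (simp_all add: distrib_left)
        then have U: "Poly_Mapping.lookup t U \<le> q k + q (k + 1)"
          and V: "Poly_Mapping.lookup t V \<le> p k + p (k + 1)"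
          using d by (simp_all flip: of_nat_add)
        show ?thesis
        proof (cases w)
          case (X j)
          then have j: "j \<in> {1..n}" using w by auto
          then have "Poly_Mapping.lookup t (X j) \<le> \<psi> j t"
            using box[of j] by (auto simp: c_def h_def r_def \<psi>_x_ray)
          also have "\<dots> \<le> a j * Poly_Mapping.lookup t U + b j * Poly_Mapping.lookup t V"
            by (simp add: \<psi>_def)
          also have "\<dots> \<le> m (X j)"
            unfolding m_def using U V by (simp add: add_mono)
          finally show ?thesis using X by simp
        qed (use U V in \<open>simp_all add: m_def\<close>)
      qed
      then show ?thesis
        by (rule finite_bounded_exponents[OF finite_W, rotated]) simp_all
    qed
    then have "polynomial_in W (mps_mult (indicator_series ?C) (Poly_Mapping.lookup (denominator (r ` ?I))))"
      unfolding series[unfolded cone] by (rule polynomial_in_indicator) simp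
    then show ?thesis
    proof (rule polynomial_in_denominator_mono[OF _ finite_rays keys_rays])
      show "r ` ?I \<subseteq> rays"
        using k by (auto simp: r_def rays_def)
    qed
  qed
qed

text \<open>
  What is left after the cones between consecutive rays is the part of \<open>B\<close> above the last ray alone,
  that is, the exponents in which \<open>V\<close> does not occur.
\<close>

lemma polynomial_last_ray:
  "polynomial_in W (mps_mult (indicator_series {t \<in> B. 0 \<le> slope_gap (n + 1) t})
    (Poly_Mapping.lookup (denominator rays)))"
proof -
  let ?C = "{t \<in> B. 0 \<le> slope_gap (n + 1) t}"
  define r where "r i = (if i = n + 1 then ray (n + 1) else x_ray i)" for i
  define h where "h i t = (if i = n + 1 then int (Poly_Mapping.lookup t U)
    else int (Poly_Mapping.lookup t (X i)) - int (a i * Poly_Mapping.lookup t U))"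
    for i and t :: "var \<Rightarrow>\<^sub>0 nat"
  let ?I = "{1..n + 1}" and ?G = "{t. Poly_Mapping.keys t \<subseteq> W \<and> Poly_Mapping.lookup t V = 0}"
  have I: "?I = insert (n + 1) {1..n}" by auto
  note pq = pq_last[simplified]
  have keys_r: "Poly_Mapping.keys (r i) \<subseteq> W" if "i \<in> ?I" for i
    using that keys_ray keys_x_ray[of i] by (auto simp: r_def)
  have cone: "{t \<in> ?G. \<forall>i\<in>?I. 0 \<le> h i t} = ?C"
  proof -
    have "0 \<le> h i t \<longleftrightarrow> a i * Poly_Mapping.lookup t U \<le> Poly_Mapping.lookup t (X i)"
      if "i \<in> {1..n}" for i t
      using that by (simp add: h_def flip: of_nat_mult)
    moreover have "0 \<le> h (n + 1) t" for t
      by (simp add: h_def)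
    ultimately have "(\<forall>i\<in>?I. 0 \<le> h i t) \<longleftrightarrow>
        (\<forall>j\<in>{1..n}. a j * Poly_Mapping.lookup t U \<le> Poly_Mapping.lookup t (X j))" for t
      unfolding I by blast
    then have "t \<in> ?C \<longleftrightarrow> t \<in> ?G \<and> (\<forall>i\<in>?I. 0 \<le> h i t)" for t
      by (auto simp: slope_gap_def pq exponent_monoid_def)
    then show ?thesis by blast
  qed
  have series: "mps_mult (indicator_series {t \<in> ?G. \<forall>i\<in>?I. 0 \<le> h i t})
      (Poly_Mapping.lookup (denominator (r ` ?I))) =
    indicator_series {t \<in> ?G. \<forall>i\<in>?I. 0 \<le> h i t \<and> h i t < 0 + h i (r i)}"
  proof (rule simplicial_cone_series)
    show "additive_weight (h i)" if "i \<in> ?I" for i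
      by (auto simp: additive_weight_def h_def lookup_add algebra_simps)
    show "h i (r j) = 0" if "i \<in> ?I" "j \<in> ?I" "i \<noteq> j" for i j
      using that by (auto simp: h_def r_def pq)
    show "h i (r i) > 0" if "i \<in> ?I" for i
      using that by (auto simp: h_def r_def pq)
    show "t + r i \<in> ?G" if "i \<in> ?I" "t \<in> ?G" for i t
      using that keys_r[OF that(1)] by (auto simp: keys_plus_subset lookup_add r_def pq)
    show "\<exists>u\<in>?G. t = u + r i"
      if i: "i \<in> ?I" and t: "t \<in> ?G" and c: "\<And>j. j \<in> ?I \<Longrightarrow> 0 \<le> h j t"
        and large: "0 + h i (r i) \<le> h i t" for i t
    proof -
      have x: "a j * Poly_Mapping.lookup t U \<le> Poly_Mapping.lookup t (X j)" if "j \<in> {1..n}" for j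
        using c[of j] that by (auto simp: h_def simp flip: of_nat_mult)
      have "Poly_Mapping.lookup (r i) w \<le> Poly_Mapping.lookup t w" for w
      proof (cases "i = n + 1")
        case True
        then have U: "1 \<le> Poly_Mapping.lookup t U"
          using large by (simp add: h_def r_def pq)
        have "a j \<le> Poly_Mapping.lookup t (X j)" if "j \<in> {1..n}" for j
          using x[OF that] U by (metis le_trans mult.right_neutral mult_le_mono2)
        then show ?thesis
          using U True by (cases w) (auto simp: r_def pq)
      next
        case False
        then have "1 \<le> int (Poly_Mapping.lookup t (X i)) - int (a i * Poly_Mapping.lookup t U)"
          using large by (simp add: h_def r_def)
        then have "1 \<le> Poly_Mapping.lookup t (X i)"
          by linarith
        then show ?thesis
          using False by (cases w) (auto simp: r_def)
      qed
      then show ?thesis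
        using exponent_divides[of "r i" t] t
        by (intro bexI[of _ "t - r i"]) (auto simp: lookup_minus)
    qed
  qed simp
  have "finite {t \<in> ?G. \<forall>i\<in>?I. 0 \<le> h i t \<and> h i t < 0 + h i (r i)}" (is "finite ?box")
  proof -
    have "Poly_Mapping.lookup t w \<le> 0" if t: "t \<in> ?box" and w: "w \<in> W" for t w
    proof -
      have box: "0 \<le> h i t \<and> h i t < 0 + h i (r i)" if "i \<in> ?I" for i
        using t that by blast
      have U: "Poly_Mapping.lookup t U = 0"
        using box[of "n + 1"] by (simp add: h_def r_def pq)
      have V: "Poly_Mapping.lookup t V = 0"
        using t by blast
      have X: "Poly_Mapping.lookup t (X j) = 0" if "j \<in> {1..n}" for j
        using box[of j] that U by (simp add: h_def r_def)
      show ?thesis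
        using w U V X by (cases w) auto
    qed
    then show ?thesis
      by (rule finite_bounded_exponents[OF finite_W, rotated]) simp_all
  qed
  then have "polynomial_in W (mps_mult (indicator_series ?C) (Poly_Mapping.lookup (denominator (r ` ?I))))"
    unfolding series[unfolded cone] by (rule polynomial_in_indicator) simp
  then show ?thesis
  proof (rule polynomial_in_denominator_mono[OF _ finite_rays keys_rays])
    show "r ` ?I \<subseteq> rays"
      unfolding I by (auto simp: r_def rays_def)
  qed
qed

text \<open>
  In a descending induction over the rays, each step adds the half-open cone between two consecutive
  rays; at ray 0, the \<open>V\<close>-axis, all of \<open>B\<close> is reached.
\<close>

lemma polynomial_numerator:
  "polynomial_in W (mps_mult (indicator_series B) (Poly_Mapping.lookup (denominator rays)))"
proof -
  let ?C = "\<lambda>k. {t \<in> B. 0 \<le> slope_gap k t}"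
  have "polynomial_in W (mps_mult (indicator_series (?C k)) (Poly_Mapping.lookup (denominator rays)))"
    if "k \<le> n + 1" for k
    using that
  proof (induction k rule: inc_induct)
    case base
    show ?case by (rule polynomial_last_ray)
  next
    case (step k)
    let ?D = "{t \<in> B. 0 \<le> slope_gap k t \<and> slope_gap (k + 1) t < 0}"
    have Un: "?C k = ?C (Suc k) \<union> ?D"
      using slope_gap_mono(1)[of k "Suc k"] step.hyps by auto
    have disjoint: "?C (Suc k) \<inter> ?D = {}"
      by auto
    have split: "mps_mult (indicator_series (?C k)) (Poly_Mapping.lookup (denominator rays)) =
        (\<lambda>t. mps_mult (indicator_series (?C (Suc k))) (Poly_Mapping.lookup (denominator rays)) t +
          mps_mult (indicator_series ?D) (Poly_Mapping.lookup (denominator rays)) t)"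
      by (subst Un, subst indicator_series_disjoint_Un[OF disjoint]) (rule mps_mult_add_left)
    have "k \<le> n"
      using step.hyps by simp
    then show ?case
      unfolding split by (intro polynomial_in_add step.IH polynomial_cone)
  qed
  from this[of 0] show ?thesis
    by (simp add: slope_gap_def pq_first)
qed

lemma B_zero: "0 \<in> B"
  by (simp add: exponent_monoid_def)

lemma B_add:
  assumes "s \<in> B" "t \<in> B"
  shows "s + t \<in> B"
proof -
  have "Poly_Mapping.keys s \<subseteq> W" "Poly_Mapping.keys t \<subseteq> W"
    using assms unfolding exponent_monoid_def by blast+
  then have "Poly_Mapping.keys (s + t) \<subseteq> W"
    by (rule keys_plus_subset)
  moreover have "max (a j * Poly_Mapping.lookup (s + t) U) (b j * Poly_Mapping.lookup (s + t) V)
      \<le> Poly_Mapping.lookup (s + t) (X j)" if "j \<in> {1..n}" for j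
  proof -
    have "a j * Poly_Mapping.lookup s U \<le> Poly_Mapping.lookup s (X j)"
      "b j * Poly_Mapping.lookup s V \<le> Poly_Mapping.lookup s (X j)"
      "a j * Poly_Mapping.lookup t U \<le> Poly_Mapping.lookup t (X j)"
      "b j * Poly_Mapping.lookup t V \<le> Poly_Mapping.lookup t (X j)"
      using assms that by (auto simp: exponent_monoid_def)
    then show ?thesis
      by (simp add: lookup_add distrib_left add_mono)
  qed
  ultimately show ?thesis
    by (simp add: exponent_monoid_def)
qed

lemma rays_subset_B: "rays \<subseteq> B"
proof
  fix e
  assume e: "e \<in> rays"
  have "max (a j * Poly_Mapping.lookup e U) (b j * Poly_Mapping.lookup e V) \<le> Poly_Mapping.lookup e (X j)"
    if "j \<in> {1..n}" for j
    using e that by (auto simp: rays_def)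
  then show "e \<in> B"
    using keys_rays[OF e] by (simp add: exponent_monoid_def)
qed

text \<open>
  Already the exponents of \<open>U\<close> and \<open>V\<close> in \<open>ray i\<close> are coprime.
\<close>

lemma rays_primitive:
  assumes "e \<in> rays"
  shows "\<exists>\<beta>. additive_weight \<beta> \<and> \<beta> e = 1"
proof -
  consider j where "j \<in> {1..n}" "e = x_ray j" | i where "i \<le> n + 1" "e = ray i"
    using assms by (auto simp: rays_def)
  then show ?thesis
  proof cases
    case 1
    then show ?thesis
      by (intro exI[of _ "\<lambda>t. int (Poly_Mapping.lookup t (X j))"])
        (simp add: additive_weight_def lookup_add)
  next
    case 2
    then obtain u v where "u * int (p i) + v * int (q i) = 1"
      using coprime_bezout_nat coprime_pq by blast
    then show ?thesis
      using 2
      by (intro exI[of _ "\<lambda>t. u * int (Poly_Mapping.lookup t V) + v * int (Poly_Mapping.lookup t U)"])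
        (simp add: additive_weight_def lookup_add algebra_simps)
  qed
qed

lemma same_ray:
  assumes "i \<le> n + 1" "j \<le> n + 1" and "p i * q j = p j * q i"
  shows "ray i = ray j"
proof -
  have "p i dvd p j * q i" "p j dvd p i * q j"
    using assms(3) by (metis dvd_triv_left)+
  then have "p i dvd p j" "p j dvd p i"
    using coprime_pq assms(1,2) by (simp_all add: coprime_dvd_mult_left_iff)
  then have p: "p i = p j"
    by (rule dvd_antisym)
  have "q i dvd q j * p i" "q j dvd q i * p j"
    using assms(3) by (metis dvd_triv_right mult.commute)+
  then have "q i dvd q j" "q j dvd q i"
    using coprime_pq assms(1,2) by (simp_all add: coprime_commute coprime_dvd_mult_left_iff)
  then have "q i = q j"
    by (rule dvd_antisym)
  with p show ?thesis
    by (simp add: ray_def)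
qed

text \<open>
  On \<open>B\<close>, the sum of all exponents except that of \<open>X i\<close> vanishes only at multiples of \<open>x_ray i\<close>.
\<close>

lemma x_ray_face:
  assumes i: "i \<in> {1..n}"
  shows "\<exists>L. additive_weight L \<and> (\<forall>t\<in>B. L t \<ge> 0) \<and> L (x_ray i) = 0 \<and>
    (\<forall>e\<in>rays - {x_ray i}. L e > 0)"
proof -
  define L where "L t = int (Poly_Mapping.lookup t U) + int (Poly_Mapping.lookup t V) +
    (\<Sum>j\<in>{1..n} - {i}. int (Poly_Mapping.lookup t (X j)))" for t
  have "additive_weight L"
    by (simp add: additive_weight_def L_def lookup_add sum.distrib)
  moreover have "\<forall>t\<in>B. L t \<ge> 0"
    by (simp add: L_def sum_nonneg)
  moreover have "L (x_ray i) = 0"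
    by (auto simp: L_def intro!: sum.neutral)
  moreover have "L e > 0" if e: "e \<in> rays - {x_ray i}" for e
  proof -
    consider j where "j \<in> {1..n}" "e = x_ray j" | l where "l \<le> n + 1" "e = ray l"
      using e by (auto simp: rays_def)
    then show ?thesis
    proof cases
      case 1
      with e have "j \<noteq> i" by blast
      with 1 have "1 \<le> (\<Sum>l\<in>{1..n} - {i}. int (Poly_Mapping.lookup e (X l)))"
        using member_le_sum[of j "{1..n} - {i}" "\<lambda>l. int (Poly_Mapping.lookup e (X l))"] 1
        by simp
      then show ?thesis
        by (simp add: L_def)
    next
      case 2
      have "0 < p l + q l"
        using coprime_pq[OF 2(1)] by (cases "p l = 0") auto
      then have "0 < int (q l) + int (p l)"
        by linarith
      moreover have "0 \<le> (\<Sum>j\<in>{1..n} - {i}. int (Poly_Mapping.lookup e (X j)))"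
        by (simp add: sum_nonneg)
      moreover have "L e = int (q l) + int (p l) + (\<Sum>j\<in>{1..n} - {i}. int (Poly_Mapping.lookup e (X j)))"
        by (simp only: L_def 2(2) lookup_ray)
      ultimately show ?thesis
        by linarith
    qed
  qed
  ultimately show ?thesis
    by blast
qed

text \<open>
  The functional in \<open>ray_face\<close> follows the bounding function near \<open>ray i\<close>, choosing the larger of
  $a_j\rho$ and $b_j\sigma$ for each \<open>j\<close>. Where both are equal along the ray the choice is arbitrary,
  and the functional may then vanish on a whole cone next to the ray. The functional \<open>K\<close> removes the
  side to which \<open>ray_face\<close> is blind. If \<open>ray i\<close> is not over an axis, then \<open>i\<close> itself is an index at
  which the bounding function bends, and \<open>K\<close> measures the height above $b_i\sigma$, the linear piece
  not used there.
\<close>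

lemma ray_tie_breaker:
  assumes i: "i \<le> n + 1"
  shows "\<exists>K. additive_weight K \<and> (\<forall>t\<in>B. K t \<ge> 0) \<and> K (ray i) = 0 \<and>
    (\<forall>l\<le>n + 1. ray l \<noteq> ray i \<longrightarrow>
      K (ray l) > 0 \<or> (\<exists>j\<in>{1..n}. a j * q i = b j * p i \<and> a j * q l < b j * p l))"
proof -
  consider "p i = 0" | "q i = 0" | "p i > 0" "q i > 0"
    by blast
  then show ?thesis
  proof cases
    case 1
    have "p l > 0" if "l \<le> n + 1" "ray l \<noteq> ray i" for l
      using same_ray[OF that(1) i] that(2) 1 by (cases "p l = 0") auto
    then show ?thesis
      using 1 by (intro exI[of _ "\<lambda>t. int (Poly_Mapping.lookup t V)"])
        (simp add: additive_weight_def lookup_add)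
  next
    case 2
    have "q l > 0" if "l \<le> n + 1" "ray l \<noteq> ray i" for l
      using same_ray[OF that(1) i] that(2) 2 by (cases "q l = 0") auto
    then show ?thesis
      using 2 by (intro exI[of _ "\<lambda>t. int (Poly_Mapping.lookup t U)"])
        (simp add: additive_weight_def lookup_add)
  next
    case 3
    have "i \<noteq> 0" "i \<noteq> n + 1"
      using 3 pq_first pq_last by (metis less_irrefl)+
    then have i1: "i \<in> {1..n}"
      using i by auto
    obtain g where g: "a i = g * p i" "b i = g * q i"
      using fraction_multiple[OF i] .
    have "g > 0"
    proof (rule ccontr)
      assume "\<not> g > 0"
      then have "b i = 0" using g by simp
      then show False
        using reduced[OF i] 3 by (simp add: reduced_fraction_def)
    qed
    define K where "K t = int (Poly_Mapping.lookup t (X i)) - int (b i * Poly_Mapping.lookup t V)" for t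
    have "additive_weight K"
      by (simp add: additive_weight_def K_def lookup_add algebra_simps)
    moreover have "\<forall>t\<in>B. K t \<ge> 0"
    proof
      fix t
      assume "t \<in> B"
      then have "b i * Poly_Mapping.lookup t V \<le> Poly_Mapping.lookup t (X i)"
        using i1 by (auto simp: exponent_monoid_def)
      then show "K t \<ge> 0"
        by (simp add: K_def flip: of_nat_mult)
    qed
    moreover have tie: "a i * q i = b i * p i"
      by (simp add: g)
    then have "K (ray i) = 0"
      using i1 by (simp add: K_def flip: of_nat_mult)
    moreover have "K (ray l) > 0 \<or> a i * q l < b i * p l" if l: "l \<le> n + 1" "ray l \<noteq> ray i" for l
    proof (rule ccontr)
      assume "\<not> (K (ray l) > 0 \<or> a i * q l < b i * p l)"
      then have "max (a i * q l) (b i * p l) \<le> b i * p l" "b i * p l \<le> a i * q l"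
        using i1 by (auto simp: K_def simp flip: of_nat_mult split: if_splits)
      then have "g * (p i * q l) \<le> g * (p l * q i)" "g * (p l * q i) \<le> g * (p i * q l)"
        by (simp_all add: g ac_simps)
      then have "p l * q i = p i * q l"
        using \<open>g > 0\<close> by simp
      then show False
        using same_ray[OF l(1) i] l(2) by blast
    qed
    ultimately show ?thesis
      using i1 tie by blast
  qed
qed

text \<open>
  The functional adds up, over all \<open>j\<close>, the height above the linear piece \<open>\<psi> j\<close> of the bounding
  function that is active at \<open>ray i\<close>. By convexity it is nonnegative on \<open>B\<close>; the tie breaker makes it
  positive on both sides of the ray.
\<close>

lemma ray_face:
  assumes i: "i \<le> n + 1"
  shows "\<exists>L. additive_weight L \<and> (\<forall>t\<in>B. L t \<ge> 0) \<and> L (ray i) = 0 \<and>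
    (\<forall>e\<in>rays - {ray i}. L e > 0)"
proof -
  define \<psi> where "\<psi> j t = (if b j * p i \<le> a j * q i then a j * Poly_Mapping.lookup t U
    else b j * Poly_Mapping.lookup t V)" for j and t :: "var \<Rightarrow>\<^sub>0 nat"
  define M where "M t = (\<Sum>j = 1..n. int (Poly_Mapping.lookup t (X j)) - int (\<psi> j t))" for t
  obtain K where K: "additive_weight K" "\<And>t. t \<in> B \<Longrightarrow> K t \<ge> 0" "K (ray i) = 0"
    and K_ray: "\<And>l. l \<le> n + 1 \<Longrightarrow> ray l \<noteq> ray i \<Longrightarrow>
      K (ray l) > 0 \<or> (\<exists>j\<in>{1..n}. a j * q i = b j * p i \<and> a j * q l < b j * p l)"
    using ray_tie_breaker[OF i] by blast
  have summand: "0 \<le> int (Poly_Mapping.lookup t (X j)) - int (\<psi> j t)" if "t \<in> B" "j \<in> {1..n}" for t j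
    using that by (auto simp: \<psi>_def exponent_monoid_def simp flip: of_nat_mult)
  have M_nonneg: "M t \<ge> 0" if "t \<in> B" for t
    unfolding M_def using summand[OF that] by (rule sum_nonneg)
  have M_pos: "M t > 0" if "t \<in> B" "j \<in> {1..n}" "\<psi> j t < Poly_Mapping.lookup t (X j)" for t j
    unfolding M_def using that by (intro sum_pos2[of _ j] summand) auto
  have "additive_weight (\<lambda>t. K t + M t)"
    using K(1) by (auto simp: additive_weight_def M_def \<psi>_def lookup_add algebra_simps
        simp flip: sum.distrib intro!: sum.cong)
  moreover have "\<forall>t\<in>B. 0 \<le> K t + M t"
    using K(2) M_nonneg by simp
  moreover have "K (ray i) + M (ray i) = 0"
    using K(3) by (auto simp: M_def \<psi>_def intro!: sum.neutral)
  moreover have "0 < K e + M e" if e: "e \<in> rays - {ray i}" for e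
  proof -
    have eB: "e \<in> B"
      using e rays_subset_B by blast
    consider j where "j \<in> {1..n}" "e = x_ray j" | l where "l \<le> n + 1" "e = ray l"
      using e by (auto simp: rays_def)
    then show ?thesis
    proof cases
      case 1
      then have "M e > 0"
        by (intro M_pos[OF eB, of j]) (simp_all add: \<psi>_def)
      then show ?thesis
        using K(2)[OF eB] by simp
    next
      case 2
      then consider "K e > 0" | j where "j \<in> {1..n}" "a j * q i = b j * p i" "a j * q l < b j * p l"
        using K_ray[of l] e by auto
      then show ?thesis
      proof cases
        case 1
        then show ?thesis
          using M_nonneg[OF eB] by simp
      next
        case (2 j)
        then have "M e > 0"
          using \<open>e = ray l\<close> by (intro M_pos[OF eB, of j]) (simp_all add: \<psi>_def)
        then show ?thesis
          using K(2)[OF eB] by simp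
      qed
    qed
  qed
  ultimately show ?thesis
    by (intro exI[of _ "\<lambda>t. K t + M t"]) blast
qed

lemma hilbert_series_lowest_terms:
  "lowest_terms_denominator W (indicator_series B) (denominator rays)"
proof (rule lowest_terms_denominator_of_extreme_rays)
  show "\<exists>L. additive_weight L \<and> (\<forall>t\<in>B. L t \<ge> 0) \<and> L e = 0 \<and> (\<forall>e'\<in>rays - {e}. L e' > 0)"
    if e: "e \<in> rays" for e
  proof -
    consider j where "j \<in> {1..n}" "e = x_ray j" | l where "l \<le> n + 1" "e = ray l"
      using e by (auto simp: rays_def)
    then show ?thesis
      by cases (simp_all only: x_ray_face ray_face)
  qed
qed (fact finite_rays rays_subset_B B_zero polynomial_numerator | erule (1) B_add keys_rays rays_primitive
    | erule keys_rays rays_primitive)+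

abbreviation ray_monomial :: "nat \<Rightarrow> rat mpoly"
  where "ray_monomial i \<equiv> indet U ^ q i * indet V ^ p i *
    (\<Prod>j = 1..n. indet (X j) ^ max (a j * q i) (b j * p i))"

lemma ray_monomial_eq: "ray_monomial i = monom (ray i)"
  by (simp only: prod_indet_power) (simp add: indet_power mult_single ray_def)

lemma denominator_rays:
  "denominator rays = (\<Prod>i = 1..n. 1 - indet (X i)) * (\<Prod>w\<in>ray_monomial ` {0..n + 1}. 1 - w)"
proof -
  have disjoint: "x_ray ` {1..n} \<inter> ray ` {0..n + 1} = {}"
  proof -
    have "x_ray j \<noteq> ray i" if "i \<le> n + 1" for i j
    proof
      assume "x_ray j = ray i"
      then have "p i = 0" "q i = 0"
        by (metis lookup_ray(1,2) lookup_x_ray(1,2))+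
      then show False
        using coprime_pq[OF that] by simp
    qed
    then show ?thesis by auto
  qed
  have inj: "inj_on x_ray {1..n}"
    by (rule inj_onI) (metis lookup_x_ray(3) zero_neq_one)
  have x: "(\<Prod>e\<in>x_ray ` {1..n}. 1 - monom e) = (\<Prod>i = 1..n. 1 - indet (X i))"
    by (subst prod.reindex[OF inj]) (simp add: indet_eq x_ray_def)
  have "inj_on monom (ray ` {0..n + 1})"
    by (simp add: inj_on_def single_1_inject)
  then have "(\<Prod>e\<in>ray ` {0..n + 1}. 1 - monom e) =
      (\<Prod>w\<in>monom ` ray ` {0..n + 1}. 1 - w)"
    by (simp add: prod.reindex)
  also have "monom ` ray ` {0..n + 1} = ray_monomial ` {0..n + 1}"
    by (simp only: ray_monomial_eq image_image)
  finally show ?thesis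
    unfolding denominator_def rays_def
    by (subst prod.union_disjoint[OF _ _ disjoint]) (simp_all only: x finite_imageI finite_atLeastAtMost)
qed

lemma inj_ray_monomial:
  assumes "inj_on (\<lambda>i. (p i, q i)) {0..n + 1}"
  shows "inj_on ray_monomial {0..n + 1}"
proof (rule inj_onI)
  fix i j
  assume ij: "i \<in> {0..n + 1}" "j \<in> {0..n + 1}" and "ray_monomial i = ray_monomial j"
  then have "ray i = ray j"
    by (simp only: ray_monomial_eq single_1_inject)
  then have "(p i, q i) = (p j, q j)"
    by (metis lookup_ray(1,2))
  then show "i = j"
    using assms ij by (auto dest: inj_onD)
qed

theorem hilbert_series_denominator:
  "lowest_terms_denominator W
    (hilbert_series (intersection_algebra (xring n)
      (monomial_ideal n a :: 'k::comm_ring_1 mpoly set) (monomial_ideal n b)))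
    ((\<Prod>i = 1..n. 1 - indet (X i)) * (\<Prod>w\<in>ray_monomial ` {0..n + 1}. 1 - w))"
  unfolding hilbert_series_intersection_algebra denominator_rays[symmetric]
  by (rule hilbert_series_lowest_terms)

corollary hilbert_series_denominator_distinct:
  assumes "inj_on (\<lambda>i. (p i, q i)) {0..n + 1}"
  shows "lowest_terms_denominator W
    (hilbert_series (intersection_algebra (xring n)
      (monomial_ideal n a :: 'k::comm_ring_1 mpoly set) (monomial_ideal n b)))
    ((\<Prod>i = 1..n. 1 - indet (X i)) * (\<Prod>i = 0..n + 1. 1 - ray_monomial i))"
  using hilbert_series_denominator
  by (simp only: prod.reindex[OF inj_ray_monomial[OF assms]] o_def)

end

section \<open>The theorem\<close>

lemma fan_one_variable:
  assumes "reduced_fraction a b p q"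
  shows "fan 1 (\<lambda>i. if i = 0 then 1 else if i = 1 then a else 0)
    (\<lambda>i. if i = 0 then 0 else if i = 1 then b else 1)
    (\<lambda>i. if i = 0 then 1 else if i = 1 then p else 0)
    (\<lambda>i. if i = 0 then 0 else if i = 1 then q else 1)"
  using assms by unfold_locales (auto simp: fan_ordered_def reduced_fraction_def)

lemma one_variable_denominators:
  assumes ab: "reduced_fraction a b p q"
  defines "H \<equiv> hilbert_series (intersection_algebra (xring 1)
    (monomial_ideal 1 (\<lambda>_. a) :: 'k::comm_ring_1 mpoly set) (monomial_ideal 1 (\<lambda>_. b)))"
  shows "lowest_terms_denominator {U, V, X 1} H
      ((1 - indet (X 1)) * (\<Prod>w\<in>{indet U * indet (X 1) ^ a, indet V * indet (X 1) ^ b,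
        indet U ^ q * indet V ^ p * indet (X 1) ^ (p * b)}. 1 - w))" (is ?set)
    and "a > 0 \<Longrightarrow> b > 0 \<Longrightarrow> lowest_terms_denominator {U, V, X 1} H
      ((1 - indet (X 1)) * (1 - indet U * indet (X 1) ^ a) * (1 - indet V * indet (X 1) ^ b) *
        (1 - indet U ^ q * indet V ^ p * indet (X 1) ^ (p * b)))" (is "_ \<Longrightarrow> _ \<Longrightarrow> ?list")
proof -
  define a' b' p' q' :: "nat \<Rightarrow> nat"
    where defs: "a' = (\<lambda>i. if i = 0 then 1 else if i = 1 then a else 0)"
      "b' = (\<lambda>i. if i = 0 then 0 else if i = 1 then b else 1)"
      "p' = (\<lambda>i. if i = 0 then 1 else if i = 1 then p else 0)"
      "q' = (\<lambda>i. if i = 0 then 0 else if i = 1 then q else 1)"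
  interpret fan 1 a' b' p' q'
    unfolding defs by (rule fan_one_variable[OF ab])
  obtain g where "a = g * p" "b = g * q"
    using fraction_multiple[of 1] by (auto simp: defs)
  then have tie: "a * q = p * b" "b * p = p * b"
    by simp_all
  have ray_monomials: "ray_monomial 0 = indet V * indet (X 1) ^ b"
    "ray_monomial 1 = indet U ^ q * indet V ^ p * indet (X 1) ^ (p * b)"
    "ray_monomial 2 = indet U * indet (X 1) ^ a"
    by (simp_all add: defs tie)
  have H: "H = hilbert_series (intersection_algebra (xring 1)
      (monomial_ideal 1 a' :: 'k mpoly set) (monomial_ideal 1 b'))"
    by (simp add: H_def monomial_ideal_def defs)
  have indices: "{0..1 + 1} = {0, 1, 2 :: nat}"
    by auto
  have W: "W = {U, V, X 1}"
    by auto
  have image: "ray_monomial ` {0..1 + 1} = {ray_monomial 2, ray_monomial 0, ray_monomial 1}"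
    unfolding indices by blast
  show ?set
    using hilbert_series_denominator[where 'k = 'k]
    unfolding W image H[symmetric] unfolding ray_monomials by simp
  assume "a > 0" "b > 0"
  then have "p > 0" "q > 0"
    using \<open>a = g * p\<close> \<open>b = g * q\<close> by simp_all
  then have inj: "inj_on (\<lambda>i. (p' i, q' i)) {0..1 + 1}"
    unfolding indices by (auto simp: inj_on_def defs)
  have prod: "(\<Prod>i = 0..1 + 1. 1 - ray_monomial i) =
      (1 - ray_monomial 2) * (1 - ray_monomial 0) * (1 - ray_monomial 1)"
    unfolding indices by simp
  show ?list
    using hilbert_series_denominator_distinct[OF inj, where 'k = 'k]
    unfolding W prod H[symmetric] unfolding ray_monomials by (simp add: mult.assoc)
qed

theorem corollary2p12:
  fixes r s :: "rat mpoly" and m :: "nat \<Rightarrow> rat mpoly"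
  assumes "r = indet U" and "s = indet V" and "m = (\<lambda>i. indet (X i))"
  shows
   "(\<forall>(n::nat) (a::nat \<Rightarrow> nat) (b::nat \<Rightarrow> nat) (p::nat \<Rightarrow> nat) (q::nat \<Rightarrow> nat).
       fan_ordered n a b \<and>
       a 0 = 1 \<and> b 0 = 0 \<and> a (n + 1) = 0 \<and> b (n + 1) = 1 \<and>
       (\<forall>i \<in> {0..n + 1}. reduced_fraction (a i) (b i) (p i) (q i)) \<longrightarrow>
       (let B = intersection_algebra (xring n)
                  (monomial_ideal n a :: 'k::field mpoly set) (monomial_ideal n b);
            H = hilbert_series B;
            W = {U, V} \<union> X ` {1..n};
            \<mu> = (\<lambda>i. r ^ q i * s ^ p i * (\<Prod>j = 1..n. m j ^ max (a j * q i) (b j * p i)))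
        in lowest_terms_denominator W H
             ((\<Prod>i = 1..n. 1 - m i) * (\<Prod>w \<in> \<mu> ` {0..n + 1}. 1 - w)) \<and>
           (inj_on (\<lambda>i. (p i, q i)) {0..n + 1} \<longrightarrow>
            lowest_terms_denominator W H
             ((\<Prod>i = 1..n. 1 - m i) * (\<Prod>i = 0..n + 1. 1 - \<mu> i)))))
    \<and>
    (\<forall>(a::nat) (b::nat) (p::nat) (q::nat).
       reduced_fraction a b p q \<longrightarrow>
       (let B = intersection_algebra (xring 1)
                  (monomial_ideal 1 (\<lambda>_. a) :: 'k mpoly set) (monomial_ideal 1 (\<lambda>_. b));
            H = hilbert_series B;
            W = {U, V, X 1}
        in lowest_terms_denominator W H
             ((1 - m 1) * (\<Prod>w \<in> {r * m 1 ^ a, s * m 1 ^ b, r ^ q * s ^ p * m 1 ^ (p * b)}. 1 - w)) \<and>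
           (a > 0 \<and> b > 0 \<longrightarrow>
            lowest_terms_denominator W H
             ((1 - m 1) * (1 - r * m 1 ^ a) * (1 - s * m 1 ^ b) * (1 - r ^ q * s ^ p * m 1 ^ (p * b))))))"
  unfolding Let_def assms
proof (intro conjI allI impI, goal_cases)
  case (1 n a b p q)
  then interpret fan n a b p q
    by unfold_locales auto
  show ?case
    using hilbert_series_denominator[where 'k = 'k] .
next
  case (2 n a b p q)
  then interpret fan n a b p q
    by unfold_locales auto
  show ?case
    using hilbert_series_denominator_distinct[OF 2(2), where 'k = 'k] .
next
  case (3 a b p q)
  then show ?case
    by (rule one_variable_denominators(1))
next
  case (4 a b p q)
  then show ?case
    by (intro one_variable_denominators(2)) auto
qed

end
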